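(* There exists an absolute constant $c>0$ such that the following holds. Let $\{\mathcal G^k(N,p)\}_N$ be any $k$-wise independent random graph with $p(N)\le 1/2$. Then, with probability tending to $1$ as $N\to\infty$, the chromatic number of $\mathcal G^k(N,p)$ satisfies $\chi\le \frac{cN\log(1/(1-p))}{\log(pN)}$, whenever either (1) $k\ge 12$ and $p(N)\ge N^{-1/75}$; or (2) $k(N)\ge\log N$ and $p(N)\ge c\frac{\log N}{N}$.
   Context: A $k$-wise independent random graph $\{\mathcal G^k(N,p)\}_N$ is a sequence, indexed by $N$, of probability distributions on simple undirected graphs with vertex set $\{1,\dots,N\}$ such that every potential edge appears with probability $p(N)$ and the indicator random variables of the appearance of any $k(N)$ potential edges are mutually independent. $\log$ is the base-2 logarithm. *)

theory Defs
  imports "HOL-Probability.Probability" "HOL-Library.Ramsey"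
begin

definition potential_edges :: "nat \<Rightarrow> nat set set" where
  "potential_edges N = nsets {1..N} 2"

(* A simple undirected graph with vertex set {1..N} is given by its edge set, a subset of
   potential_edges N. The bound card S \<le> k N, rather than equality, makes the condition mean full
   independence when k N exceeds the number of potential edges; otherwise the two are equivalent. *)
definition kwise_independent_random_graph ::
    "(nat \<Rightarrow> nat) \<Rightarrow> (nat \<Rightarrow> real) \<Rightarrow> (nat \<Rightarrow> nat set set pmf) \<Rightarrow> bool" where
  "kwise_independent_random_graph k p G \<longleftrightarrow>
    (\<forall>N. set_pmf (G N) \<subseteq> Pow (potential_edges N) \<and>
         (\<forall>e \<in> potential_edges N. measure_pmf.prob (G N) {E. e \<in> E} = p N) \<and>
         (\<forall>S \<subseteq> potential_edges N. card S \<le> k N \<longrightarrow>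
            prob_space.indep_vars (measure_pmf (G N)) (\<lambda>_. borel)
              (\<lambda>e. indicat_real {E. e \<in> E}) S))"

definition proper_colouring :: "'a set \<Rightarrow> 'a set set \<Rightarrow> nat \<Rightarrow> ('a \<Rightarrow> nat) \<Rightarrow> bool" where
  "proper_colouring V E m f \<longleftrightarrow>
    f ` V \<subseteq> {..<m} \<and> (\<forall>u \<in> V. \<forall>v \<in> V. {u, v} \<in> E \<longrightarrow> f u \<noteq> f v)"

definition chromatic_number :: "'a set \<Rightarrow> 'a set set \<Rightarrow> nat" where
  "chromatic_number V E = (LEAST m. \<exists>f. proper_colouring V E m f)"

end

(* Let d = pN and let M be the adjacency matrix with p subtracted off the diagonal. If the quadratic
   form of M is at most O(d^(7/8)) |U| on the indicator of every vertex set U, then every U has a vertex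
   of degree at most p|U| + O(d^(7/8)) within U. Hence, as long as |U| >= N d^(-1/16), a greedy choice
   gives an independent set of size of order ln d / p inside U, while smaller U span d^(15/16)-degenerate
   graphs up to a constant. Removing independent sets and then colouring the rest greedily uses
   O(d / ln d) colours.

   The quadratic form is controlled by the trace of M^n for a power of two n <= k, namely n = 8 in case (1)
   and log N / 2 < n <= log N in case (2). By n-wise independence the expected trace is a sum over closed
   walks in which every edge occurs at least twice, each contributing at most p to the number of
   distinct edges. To bound the sum, a walk is encoded by guessing its vertices one after another from the
   part already seen. As edges repeat, about n/4 of the guesses can be made among O(sqrt n) candidates
   instead of n, which is what gives an exponent of d below 1 when d is of order log N. *)
theory Submission
  imports Defs "HOL-Real_Asymp.Real_Asymp"
begin

section \<open>Sequences and adaptive guessing\<close>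

definition seqs :: "'a set \<Rightarrow> nat \<Rightarrow> 'a list set" where
  "seqs V m = {w. set w \<subseteq> V \<and> length w = m}"

lemma finite_seqs: "finite V \<Longrightarrow> finite (seqs V m)"
  unfolding seqs_def by (rule finite_lists_length_eq)

lemma sum_seqs_Suc:
  "(\<Sum>w\<in>seqs V (Suc m). g w) = (\<Sum>w\<in>seqs V m. \<Sum>z\<in>V. g (w @ [z]))"
proof -
  have bij: "bij_betw (\<lambda>(w, z). w @ [z]) (seqs V m \<times> V) (seqs V (Suc m))"
  proof (rule bij_betwI')
    fix w assume "w \<in> seqs V (Suc m)"
    then show "\<exists>x\<in>seqs V m \<times> V. w = (case x of (w, z) \<Rightarrow> w @ [z])"
      by (cases w rule: rev_cases) (auto simp: seqs_def)
  qed (auto simp: seqs_def)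
  have "(\<Sum>w\<in>seqs V (Suc m). g w) = (\<Sum>(w, z)\<in>seqs V m \<times> V. g (w @ [z]))"
    by (subst sum.reindex_bij_betw[OF bij, symmetric]) (simp add: case_prod_unfold)
  then show ?thesis by (simp add: sum.cartesian_product)
qed

text \<open>Read \<open>f h\<close> as a subprobability distribution of the next entry given the
  history \<open>h\<close>. The product is then the chance that entries drawn one after another
  spell out \<open>w\<close>, and these events are disjoint. The induction sums out the last entry
  first.\<close>

lemma sum_adaptive_weights_le_1:
  fixes f :: "'a list \<Rightarrow> 'a \<Rightarrow> real"
  assumes "\<And>h y. f h y \<ge> 0" "\<And>h. (\<Sum>y\<in>V. f h y) \<le> 1"
  shows "(\<Sum>w\<in>seqs V m. \<Prod>i<m. f (take i w) (w ! i)) \<le> 1"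
proof (induction m)
  case 0
  have "seqs V 0 = {[]}" by (auto simp: seqs_def)
  then show ?case by simp
next
  case (Suc m)
  have "(\<Sum>w\<in>seqs V (Suc m). \<Prod>i<Suc m. f (take i w) (w ! i))
      = (\<Sum>w\<in>seqs V m. \<Sum>z\<in>V. (\<Prod>i<m. f (take i w) (w ! i)) * f w z)"
    unfolding sum_seqs_Suc
    by (intro sum.cong refl) (auto simp: seqs_def nth_append intro!: prod.cong)
  also have "\<dots> = (\<Sum>w\<in>seqs V m. (\<Prod>i<m. f (take i w) (w ! i)) * (\<Sum>z\<in>V. f w z))"
    by (simp add: sum_distrib_left)
  also have "\<dots> \<le> (\<Sum>w\<in>seqs V m. (\<Prod>i<m. f (take i w) (w ! i)) * 1)"
    by (intro sum_mono mult_left_mono assms prod_nonneg) 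
  finally show ?case using Suc by simp
qed

text \<open>The uniform distribution on \<open>A\<close> at the fixed level \<open>1 / c\<close>,
  switched off when \<open>A\<close> has more than \<open>c\<close> elements. The cutoff keeps the
  total mass at most 1 for every history, while a successful guess always has weight exactly
  \<open>1 / c\<close>.\<close>

definition guess :: "'a set \<Rightarrow> real \<Rightarrow> 'a \<Rightarrow> real" where
  "guess A c y = (if y \<in> A \<and> finite A \<and> real (card A) \<le> c then 1 / c else 0)"

lemma guess_nonneg: "c \<ge> 0 \<Longrightarrow> guess A c y \<ge> 0"
  by (simp add: guess_def)

lemma sum_guess_le_1:
  assumes "finite V" "c > 0"
  shows "(\<Sum>y\<in>V. guess A c y) \<le> 1"
proof (cases "finite A \<and> real (card A) \<le> c")
  case True
  have "(\<Sum>y\<in>V. guess A c y) = (\<Sum>y\<in>V. if y \<in> A then 1 / c else 0)"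
    using True by (intro sum.cong) (auto simp: guess_def)
  also have "\<dots> = real (card (V \<inter> A)) / c"
    using assms by (simp add: sum.If_cases Int_def)
  also have "\<dots> \<le> real (card A) / c"
    using assms True by (intro divide_right_mono) (auto intro: card_mono)
  also have "\<dots> \<le> 1" using True assms by simp
  finally show ?thesis .
next
  case False
  then show ?thesis by (auto simp: guess_def)
qed

section \<open>Closed walks that repeat every edge\<close>

definition walk_edge :: "'a list \<Rightarrow> nat \<Rightarrow> 'a set" where
  "walk_edge w i = {w ! i, w ! Suc i}"

definition seen_nbrs :: "'a list \<Rightarrow> 'a set" where
  "seen_nbrs h = {y. \<exists>j. Suc j < length h \<and> walk_edge h j = {last h, y}}"

text \<open>A guess for the next vertex of a walk with history \<open>h\<close>: with probability \<open>1/4\<close> each, a uniform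
  vertex, a vertex seen before, a vertex seen at a time in \<open>S\<close>, or a neighbour of the current vertex
  along an edge already walked. The last two are made only if they have at most \<open>2 \<surd>n\<close> candidates.\<close>

definition step_weight :: "'a set \<Rightarrow> nat \<Rightarrow> nat set \<Rightarrow> 'a list \<Rightarrow> 'a \<Rightarrow> real" where
  "step_weight V n S h y =
     (if h = [] then guess V (card V) y
      else (guess V (card V) y + guess (set h) n y
        + guess ((!) h ` (S \<inter> {..<length h})) (2 * sqrt n) y
        + guess (seen_nbrs h) (2 * sqrt n) y) / 4)"

lemma step_weight_nonneg: "step_weight V n S h y \<ge> 0"
  by (simp add: step_weight_def guess_nonneg)

lemma sum_step_weight_le_1:
  assumes "finite V" "V \<noteq> {}" "n > 0"
  shows "(\<Sum>y\<in>V. step_weight V n S h y) \<le> 1"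
proof -
  have N: "real (card V) > 0" using assms by (simp add: card_gt_0_iff)
  show ?thesis
  proof (cases "h = []")
    case True
    then show ?thesis using sum_guess_le_1[OF assms(1) N] by (simp add: step_weight_def)
  next
    case False
    have "(\<Sum>y\<in>V. step_weight V n S h y) = 
      ((\<Sum>y\<in>V. guess V (card V) y) + (\<Sum>y\<in>V. guess (set h) n y)
        + (\<Sum>y\<in>V. guess ((!) h ` (S \<inter> {..<length h})) (2 * sqrt n) y)
        + (\<Sum>y\<in>V. guess (seen_nbrs h) (2 * sqrt n) y)) / 4"
      using False by (simp add: step_weight_def sum.distrib flip: sum_divide_distrib)
    also have "\<dots> \<le> (1 + 1 + 1 + 1) / 4"
      using assms N by (intro divide_right_mono add_mono sum_guess_le_1) auto
    finally show ?thesis by simp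
  qed
qed

text \<open>The closed walks whose contribution to the expected trace does not vanish: a walk of length \<open>n\<close>
  is the list of its \<open>n + 1\<close> vertices.\<close>

definition heavy_walks :: "'a set \<Rightarrow> nat \<Rightarrow> 'a list set" where
  "heavy_walks V n = {w \<in> seqs V (Suc n). w ! 0 = w ! n \<and>
     (\<forall>i<n. w ! i \<noteq> w ! Suc i) \<and> (\<forall>i<n. \<exists>j<n. j \<noteq> i \<and> walk_edge w j = walk_edge w i)}"

text \<open>Each value is counted at the index where it occurs first. For walks, this counts
  distinct edges by the steps that traverse them for the first time.\<close>

lemma card_image_eq_card_first_occurrences:
  fixes f :: "nat \<Rightarrow> 'b"
  shows "card (f ` {..<n}) = card {i. i < n \<and> f i \<notin> f ` {..<i}}"
proof (induction n)
  case (Suc n)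
  have "{i. i < Suc n \<and> f i \<notin> f ` {..<i}} =
      (if f n \<in> f ` {..<n} then {i. i < n \<and> f i \<notin> f ` {..<i}}
       else insert n {i. i < n \<and> f i \<notin> f ` {..<i}})"
    by (auto simp: less_Suc_eq)
  with Suc show ?case by (simp add: lessThan_Suc insert_absorb)
qed simp

text \<open>Every fibre has at least two elements, and the fibres partition the \<open>n\<close>
  indices. So a walk that repeats all its edges has at most \<open>n / 2\<close> distinct
  ones.\<close>

lemma card_image_le_half:
  assumes "\<forall>i<n. \<exists>j<n. j \<noteq> i \<and> f j = f i"
  shows "2 * card (f ` {..<n::nat}) \<le> n"
proof -
  have "2 \<le> card {i. i < n \<and> f i = y}" if y: "y \<in> f ` {..<n}" for y
  proof -
    from y obtain i where i: "i < n" "f i = y" by auto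
    then obtain j where j: "j < n" "j \<noteq> i" "f j = f i" using assms by blast
    have "card {i, j} \<le> card {i. i < n \<and> f i = y}"
      using i j by (intro card_mono) auto
    then show ?thesis using j by simp
  qed
  then have "(\<Sum>y\<in>f ` {..<n}. 2) \<le> (\<Sum>y\<in>f ` {..<n}. card {i. i < n \<and> f i = y})"
    by (intro sum_mono) auto
  also have "\<dots> = (\<Sum>y\<in>f ` {..<n}. \<Sum>i | i \<in> {..<n} \<and> f i = y. 1)" by simp
  also have "\<dots> = n" by (subst sum.image_gen[symmetric]) auto
  finally show ?thesis by simp
qed

text \<open>Here \<open>j\<close> counts steps to new vertices, each costing \<open>d\<close>, and
  \<open>g\<close> counts cheap steps. Of the powers of \<open>n\<close>, the part with exponent
  \<open>n / 2 - j\<close> is bounded by the same power of \<open>d\<close>; the rest has exponent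
  \<open>n / 2 - g / 2\<close>, at most \<open>3 * n / 8 + sqrt n / 4\<close> by the lower bound on
  \<open>g\<close>. The excess \<open>n powr (sqrt n / 4)\<close> is at most \<open>2 ^ n\<close>
  because \<open>ln n \<le> 2 * sqrt n\<close>.\<close>

lemma walk_cost_bound:
  fixes d :: real and n j g :: nat
  assumes "n \<ge> 1" "n \<le> d" "2 * j \<le> n" "j + g \<le> n" "2 * real g \<ge> n / 2 - sqrt n"
  shows "d ^ j * (2 * sqrt n) ^ g * real n ^ (n - j - g) \<le> 4 ^ n * d powr (n / 2) * n powr (3 * n / 8)"
proof -
  have n: "real n \<ge> 1" "d > 0" using assms by auto
  have "d ^ j * (2 * sqrt n) ^ g * real n ^ (n - j - g)
     = 2 ^ g * (d powr j * n powr (g / 2) * n powr (real n - j - g))"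
    using n assms by (simp add: power_mult_distrib powr_half_sqrt[symmetric] powr_realpow[symmetric]
        powr_powr of_nat_diff algebra_simps)
  also have "\<dots> = 2 ^ g * (d powr j * n powr (real n / 2 - j) * n powr (real n / 2 - g / 2))"
    by (simp add: mult.assoc powr_add[symmetric]) (simp add: field_simps)
  also have "\<dots> \<le> 2 ^ n * (d powr j * d powr (real n / 2 - j) * n powr (3 * n / 8 + sqrt n / 4))"
  proof (intro mult_mono)
    show "(2::real) ^ g \<le> 2 ^ n" using assms by (intro power_increasing) auto
    show "real n powr (real n / 2 - j) \<le> d powr (real n / 2 - j)"
      using assms n by (intro powr_mono2) auto
    show "real n powr (real n / 2 - g / 2) \<le> n powr (3 * n / 8 + sqrt n / 4)"
      using assms n by (intro powr_mono) auto
  qed auto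
  also have "\<dots> = 2 ^ n * d powr (n / 2) * n powr (3 * n / 8) * n powr (sqrt n / 4)"
    by (simp add: powr_add[symmetric] mult.assoc)
  also have "\<dots> \<le> 2 ^ n * d powr (n / 2) * n powr (3 * n / 8) * 2 ^ n"
  proof (intro mult_left_mono)
    have "ln (sqrt n) \<le> sqrt n - 1" using n by (intro ln_le_minus_one) auto
    then have ln: "ln n \<le> 2 * sqrt n" using n by (simp add: ln_sqrt)
    have "sqrt n / 4 * ln n \<le> sqrt n / 4 * (2 * sqrt n)"
      using ln by (intro mult_left_mono) auto
    also have "\<dots> = n * (1 / 2)" using n by simp
    also have "\<dots> \<le> n * ln 2"
      using ln2_ge_two_thirds by (intro mult_left_mono) auto
    finally have "n powr (sqrt n / 4) \<le> exp (n * ln 2)" using n by (simp add: powr_def)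
    also have "\<dots> = 2 ^ n" by (simp add: exp_of_nat_mult)
    finally show "n powr (sqrt n / 4) \<le> 2 ^ n" .
  qed auto
  also have "\<dots> = 4 ^ n * d powr (n / 2) * n powr (3 * n / 8)"
  proof -
    have "(4::real) ^ n = 2 ^ n * 2 ^ n" by (simp flip: power_mult_distrib)
    then show ?thesis by simp
  qed
  finally show ?thesis .
qed

text \<open>The shift loses the index \<open>0\<close> and gains \<open>n\<close>, where
  \<open>P\<close> agrees. On a closed walk this says that a set of vertices is entered as often as
  it is left.\<close>

lemma card_shift:
  fixes P :: "nat \<Rightarrow> bool"
  assumes "P 0 = P n"
  shows "card {i. i < n \<and> P (Suc i)} = card {i. i < n \<and> P i}"
proof -
  have eq: "{i. i < Suc m \<and> Q i} = (if Q m then insert m {i. i < m \<and> Q i} else {i. i < m \<and> Q i})"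
    for Q :: "nat \<Rightarrow> bool" and m by (auto simp: less_Suc_eq)
  have "card {i. i < m \<and> P (Suc i)} + of_bool (P 0) = card {i. i < m \<and> P i} + of_bool (P m)" for m
    by (induction m) (auto simp: eq)
  from this[of n] assms show ?thesis by simp
qed

text \<open>Take for \<open>S\<close> the times spent at vertices visited at least \<open>\<surd>n\<close> times; there are at most \<open>\<surd>n\<close>
  such vertices. A step to a new vertex costs \<open>card V\<close> but uses a new edge and so is paid by a factor
  \<open>p\<close>; any other step costs at most \<open>n\<close>. It costs only \<open>2 \<surd>n\<close> if it returns to an often visited vertex,
  or repeats an edge from a rarely visited one. Since every edge is repeated, at least half
  of the steps repeat edges. As many steps leave often visited vertices as enter them, so at least
  about a quarter of all steps are cheap.\<close>

lemma heavy_walk_weight: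
  fixes V :: "'a set" and p :: real and n :: nat
  assumes V: "finite V" and n: "n \<ge> 1" and p: "0 \<le> p" "p \<le> 1" and nd: "n \<le> p * card V"
    and w: "w \<in> heavy_walks V n"
  shows "\<exists>S\<in>Pow {..n}. p ^ card (walk_edge w ` {..<n}) \<le>
    card V * 16 ^ n * (p * card V) powr (n / 2) * n powr (3 * n / 8) *
    (\<Prod>i<Suc n. step_weight V n S (take i w) (w ! i))"
proof -
  let ?N = "real (card V)"
  have len: "length w = Suc n" and wV: "set w \<subseteq> V" and closed: "w ! 0 = w ! n"
    and heavy: "\<forall>i<n. \<exists>j<n. j \<noteq> i \<and> walk_edge w j = walk_edge w i"
    using w by (auto simp: heavy_walks_def seqs_def)
  have inV: "w ! i \<in> V" if "i \<le> n" for i using wV len that by (auto simp: subset_iff)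
  have N: "?N > 0" using V inV[of 0] by (auto simp: card_gt_0_iff)
  have sn: "sqrt n \<ge> 1" "sqrt n > 0" using n by auto
  define cnt where "cnt x = card {i. i < n \<and> w ! i = x}" for x
  define H where "H = {x \<in> set w. real (cnt x) \<ge> sqrt n}"
  define S where "S = {i. i \<le> n \<and> w ! i \<in> H}"
  define F where "F = {i. i < n \<and> w ! Suc i \<notin> set (take (Suc i) w)}"
  define E1 where "E1 = {i. i < n \<and> walk_edge w i \<notin> walk_edge w ` {..<i}}"
  \<comment> \<open>The cheap steps: not to a new vertex, and either into an often visited vertex or
    along an old edge from a rarely visited one.\<close>
  define R where "R = {i. i < n \<and> i \<notin> F \<and> (w ! Suc i \<in> H \<or> i \<notin> E1 \<and> w ! i \<notin> H)}"
  define e where "e = card (walk_edge w ` {..<n})"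
  have finH: "finite H" by (simp add: H_def)
  have fin: "finite F" "finite R" by (auto simp: F_def R_def)
  have take_set: "set (take m w) = (!) w ` {..<m}" if "m \<le> Suc n" for m
    using nth_image[of m w] that len by (simp add: lessThan_atLeast0)
  have e: "e = card E1" unfolding e_def E1_def by (rule card_image_eq_card_first_occurrences)
  have e_half: "2 * e \<le> n" unfolding e_def using card_image_le_half[OF heavy] .
  have FE1: "F \<subseteq> E1"
  proof
    fix i assume i: "i \<in> F"
    show "i \<in> E1"
    proof (rule ccontr)
      assume "i \<notin> E1"
      then obtain l where l: "l < i" "walk_edge w i = walk_edge w l" using i by (auto simp: E1_def F_def)
      then have "w ! Suc i \<in> {w ! l, w ! Suc l}" by (auto simp: walk_edge_def doubleton_eq_iff)
      then have "w ! Suc i \<in> (!) w ` {..<Suc i}" using l by auto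
      with i take_set[of "Suc i"] show False by (auto simp: F_def)
    qed
  qed
  have Fe: "card F \<le> e" unfolding e using FE1 by (intro card_mono) (auto simp: E1_def)
  have cardH: "real (card H) \<le> sqrt n"
  proof -
    have "real (card H) * sqrt n = (\<Sum>x\<in>H. sqrt n)" by simp
    also have "\<dots> \<le> (\<Sum>x\<in>H. real (cnt x))" by (intro sum_mono) (auto simp: H_def)
    also have "\<dots> = real (\<Sum>x\<in>H. cnt x)" by simp
    also have "(\<Sum>x\<in>H. cnt x) = card (\<Union>x\<in>H. {i. i < n \<and> w ! i = x})"
      unfolding cnt_def using finH by (subst card_UN_disjoint) auto
    also have "\<dots> \<le> card {..<n}" by (intro card_mono) auto
    finally have "real (card H) * sqrt n \<le> sqrt n * sqrt n" by simp
    then show ?thesis using sn(2) by (rule mult_right_le_imp_le)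
  qed
  have inj: "inj_on (\<lambda>i. w ! Suc i) F"
  proof (rule linorder_inj_onI')
    fix i j assume ij: "i \<in> F" "j \<in> F" "i < j"
    then have "w ! Suc i \<in> set (take (Suc j) w)" by (subst take_set) (auto simp: F_def)
    with ij show "w ! Suc i \<noteq> w ! Suc j" by (auto simp: F_def)
  qed
  \<comment> \<open>Entries into \<open>H\<close> that are not cheap are first visits, at most
    \<open>card H\<close> many, so \<open>card X \<le> card R + card H\<close>. A step that is not
    cheap walks a new edge or leaves \<open>H\<close>, so
    \<open>n \<le> card R + e + card Y\<close>. Since \<open>card X = card Y\<close>, adding gives
    \<open>n \<le> 2 * card R + card H + e\<close>, with \<open>e \<le> n / 2\<close> and
    \<open>card H \<le> sqrt n\<close>.\<close>
  have cardR: "2 * real (card R) \<ge> n / 2 - sqrt n"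
  proof -
    define X Y where "X = {i. i < n \<and> w ! Suc i \<in> H}" and "Y = {i. i < n \<and> w ! i \<in> H}"
    have XY: "card X = card Y" unfolding X_def Y_def
      by (rule card_shift) (simp add: closed)
    have "card (X \<inter> F) \<le> card H"
      using inj finH by (intro card_inj_on_le[of "\<lambda>i. w ! Suc i"]) (auto simp: X_def intro: inj_on_subset)
    moreover have "card X \<le> card R + card (X \<inter> F)"
    proof -
      have "card X \<le> card (R \<union> (X \<inter> F))"
        using fin by (intro card_mono) (auto simp: X_def R_def)
      also have "\<dots> \<le> card R + card (X \<inter> F)" by (rule card_Un_le)
      finally show ?thesis .
    qed
    moreover have "n \<le> card R + (card E1 + card Y)"
    proof -
      have "card {..<n} \<le> card (R \<union> (E1 \<union> Y))"
        using fin FE1 by (intro card_mono) (auto simp: R_def E1_def Y_def)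
      also have "\<dots> \<le> card R + card (E1 \<union> Y)" by (rule card_Un_le)
      also have "\<dots> \<le> card R + (card E1 + card Y)" by (simp add: card_Un_le)
      finally show ?thesis by simp
    qed
    ultimately have "n \<le> 2 * card R + card H + e" using XY e by linarith
    then have "real n \<le> 2 * card R + card H + e" by linarith
    then show ?thesis using e_half cardH by linarith
  qed
  have FR: "card F + card R \<le> n"
  proof -
    have "card F + card R = card (F \<union> R)"
      using fin by (intro card_Un_disjoint[symmetric]) (auto simp: R_def)
    also have "\<dots> \<le> card {..<n}" by (intro card_mono) (auto simp: R_def F_def)
    finally show ?thesis by simp
  qed
  define c where "c i = (if i \<in> F then ?N else if i \<in> R then 2 * sqrt n else n)" for i
  have cpos: "c i > 0" for i using N sn n by (auto simp: c_def)
  have prodc: "(\<Prod>i<n. c i) = ?N ^ card F * (2 * sqrt n) ^ card R * n ^ (n - card F - card R)"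
  proof -
    have sub: "F \<subseteq> {..<n}" "R \<subseteq> {..<n} - F" by (auto simp: F_def R_def)
    have "(\<Prod>i<n. c i) = (\<Prod>i\<in>{..<n} - F. c i) * (\<Prod>i\<in>F. c i)"
      using sub by (intro prod.subset_diff) auto
    also have "(\<Prod>i\<in>{..<n} - F. c i) = (\<Prod>i\<in>{..<n} - F - R. c i) * (\<Prod>i\<in>R. c i)"
      using sub by (intro prod.subset_diff) auto
    also have "(\<Prod>i\<in>F. c i) = ?N ^ card F" by (simp add: c_def)
    also have "(\<Prod>i\<in>R. c i) = (\<Prod>i\<in>R. 2 * sqrt n)"
      by (intro prod.cong) (auto simp: c_def R_def)
    also have "\<dots> = (2 * sqrt n) ^ card R" by simp
    also have "(\<Prod>i\<in>{..<n} - F - R. c i) = (\<Prod>i\<in>{..<n} - F - R. real n)"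
      by (intro prod.cong) (auto simp: c_def)
    also have "\<dots> = real n ^ card ({..<n} - F - R)" by simp
    also have "card ({..<n} - F - R) = n - card F - card R"
      using fin sub by (simp add: card_Diff_subset)
    finally show ?thesis by simp
  qed
  \<comment> \<open>Step \<open>i\<close> is matched with one of the four guesses, whose list has at
    most \<open>c i\<close> candidates and contains the next vertex; the 4 comes from choosing among
    the guesses.\<close>
  have low: "step_weight V n S (take (Suc i) w) (w ! Suc i) \<ge> 1 / (4 * c i)" if i: "i < n" for i
  proof -
    define h where "h = take (Suc i) w"
    have h: "length h = Suc i" "h \<noteq> []" "last h = w ! i" "\<And>l. l < Suc i \<Longrightarrow> h ! l = w ! l"
      using i len by (auto simp: h_def take_Suc_conv_app_nth nth_append less_Suc_eq)
    have seth: "set h = (!) w ` {..<Suc i}" using take_set[of "Suc i"] i by (simp add: h_def)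
    define gV gh gS gn where g_defs: "gV = guess V ?N (w ! Suc i)" "gh = guess (set h) n (w ! Suc i)"
       "gS = guess ((!) h ` (S \<inter> {..<length h})) (2 * sqrt n) (w ! Suc i)"
       "gn = guess (seen_nbrs h) (2 * sqrt n) (w ! Suc i)"
    have nn: "gV \<ge> 0" "gh \<ge> 0" "gS \<ge> 0" "gn \<ge> 0" by (simp_all add: g_defs guess_nonneg)
    have "1 / c i \<le> gV + gh + gS + gn"
    proof (cases "i \<in> F")
      case True
      have "1 / c i = gV" using True inV[of "Suc i"] i V by (simp add: c_def g_defs guess_def)
      then show ?thesis using nn by linarith
    next
      case nF: False
      then have old: "w ! Suc i \<in> set h" using i by (simp add: F_def h_def)
      show ?thesis
      proof (cases "i \<in> R")
        case True
        then have ci: "c i = 2 * sqrt n" using nF by (simp add: c_def)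
        show ?thesis
        proof (cases "w ! Suc i \<in> H")
          case True
          obtain l where l: "l < Suc i" "w ! Suc i = w ! l" using old seth by auto
          have "w ! Suc i \<in> (!) h ` (S \<inter> {..<length h})"
            using l h True i by (auto simp: S_def image_iff intro!: bexI[of _ l])
          moreover have "(!) h ` (S \<inter> {..<length h}) \<subseteq> H" using h by (auto simp: S_def)
          then have "real (card ((!) h ` (S \<inter> {..<length h}))) \<le> card H"
            using finH by (simp add: card_mono)
          then have "real (card ((!) h ` (S \<inter> {..<length h}))) \<le> 2 * sqrt n"
            using cardH sn by linarith
          ultimately have "gS = 1 / c i" by (simp add: g_defs guess_def ci)
          then show ?thesis using nn by linarith
        next
          case False
          then have iE: "i \<notin> E1" "w ! i \<notin> H" using True by (auto simp: R_def)
          then obtain l where l: "l < i" "walk_edge w i = walk_edge w l" using i by (auto simp: E1_def)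
          then have "walk_edge h l = {last h, w ! Suc i}" using h by (simp add: walk_edge_def)
          then have mem: "w ! Suc i \<in> seen_nbrs h" using l h by (auto simp: seen_nbrs_def)
          \<comment> \<open>Edges seen at the current vertex either leave it (\<open>Z\<close>) or
            enter it (\<open>Z'\<close>). By closedness both sets have as many elements as there are
            visits, at most \<open>sqrt n\<close>.\<close>
          define Z Z' where "Z = {j. j < n \<and> w ! j = w ! i}" and "Z' = {j. j < n \<and> w ! Suc j = w ! i}"
          have sub: "seen_nbrs h \<subseteq> (\<lambda>j. w ! Suc j) ` Z \<union> (\<lambda>j. w ! j) ` Z'"
          proof
            fix y assume "y \<in> seen_nbrs h"
            then obtain j where j: "Suc j < length h" "walk_edge h j = {last h, y}"
              by (auto simp: seen_nbrs_def)
            then have "{w ! j, w ! Suc j} = {w ! i, y}" "j < n" using h i by (auto simp: walk_edge_def)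
            then show "y \<in> (\<lambda>j. w ! Suc j) ` Z \<union> (\<lambda>j. w ! j) ` Z'"
              unfolding Z_def Z'_def doubleton_eq_iff by auto
          qed
          have fz: "finite Z" "finite Z'" by (auto simp: Z_def Z'_def)
          have "card (seen_nbrs h) \<le> card ((\<lambda>j. w ! Suc j) ` Z \<union> (\<lambda>j. w ! j) ` Z')"
            using sub fz by (intro card_mono) auto
          also have "\<dots> \<le> card ((\<lambda>j. w ! Suc j) ` Z) + card ((\<lambda>j. w ! j) ` Z')" by (rule card_Un_le)
          also have "\<dots> \<le> card Z + card Z'" using fz by (intro add_mono card_image_le)
          also have "card Z' = card Z" unfolding Z_def Z'_def by (rule card_shift) (simp add: closed)
          also have "card Z = cnt (w ! i)" by (simp add: Z_def cnt_def)
          finally have "real (card (seen_nbrs h)) \<le> 2 * real (cnt (w ! i))" by linarith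
          moreover have "w ! i \<in> set w" using i len by auto
          then have "real (cnt (w ! i)) \<le> sqrt n" using iE(2) by (auto simp: H_def)
          moreover have "finite (seen_nbrs h)" using sub fz by (auto intro: finite_subset)
          ultimately have "gn = 1 / c i" using mem by (simp add: g_defs guess_def ci)
          then show ?thesis using nn by linarith
        qed
      next
        case False
        have "card (set h) \<le> Suc i" using card_length[of h] h by simp
        then have "gh = 1 / c i" using False nF old i by (simp add: g_defs guess_def c_def)
        then show ?thesis using nn by linarith
      qed
    qed
    then have "1 / (4 * c i) \<le> (gV + gh + gS + gn) / 4" by (simp add: field_simps)
    also have "\<dots> = step_weight V n S h (w ! Suc i)" using h by (simp add: step_weight_def g_defs)
    finally show ?thesis by (simp add: h_def)
  qed
  define Q where "Q = (\<Prod>i<Suc n. step_weight V n S (take i w) (w ! i))"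
  \<comment> \<open>The start is guessed among all vertices, which gives the factor
    \<open>1 / ?N\<close>; the other factors are the bounds \<open>low\<close>.\<close>
  have "1 / (?N * 4 ^ n * (\<Prod>i<n. c i)) = 1 / ?N * (\<Prod>i<n. 1 / (4 * c i))"
    by (simp add: prod_dividef prod.distrib)
  also have "\<dots> \<le> 1 / ?N * (\<Prod>i<n. step_weight V n S (take (Suc i) w) (w ! Suc i))"
    using low N cpos by (intro mult_left_mono prod_mono) (auto simp: less_imp_le)
  also have "\<dots> = Q"
    unfolding Q_def using inV[of 0] V
    by (subst prod.lessThan_Suc_shift) (simp add: step_weight_def guess_def)
  finally have Q: "1 \<le> ?N * 4 ^ n * (\<Prod>i<n. c i) * Q"
    using N cpos by (simp add: pos_divide_le_eq prod_pos mult_ac)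
  have Q0: "Q \<ge> 0" unfolding Q_def by (intro prod_nonneg step_weight_nonneg) 
  have "p ^ e \<le> p ^ e * (?N * 4 ^ n * (\<Prod>i<n. c i) * Q)"
    using Q p by (simp add: mult_le_cancel_left1 zero_less_power)
  \<comment> \<open>Keeping one factor \<open>p\<close> per new vertex turns each cost
    \<open>?N\<close> into \<open>p * ?N\<close>.\<close>
  also have "\<dots> \<le> p ^ card F * (?N * 4 ^ n * (\<Prod>i<n. c i) * Q)"
    using Fe p N Q0 cpos
    by (intro mult_right_mono power_decreasing mult_nonneg_nonneg prod_nonneg) (auto intro: less_imp_le)
  also have "\<dots> = ?N * 4 ^ n * ((p * ?N) ^ card F * (2 * sqrt n) ^ card R * real n ^ (n - card F - card R)) * Q"
    by (simp add: prodc power_mult_distrib)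
  also have "\<dots> \<le> ?N * 4 ^ n * (4 ^ n * (p * ?N) powr (n / 2) * n powr (3 * n / 8)) * Q"
    using n nd e_half Fe FR cardR Q0 N
    by (intro mult_right_mono mult_left_mono walk_cost_bound) auto
  also have "\<dots> = ?N * 16 ^ n * (p * ?N) powr (n / 2) * n powr (3 * n / 8) * Q"
  proof -
    have "(16::real) ^ n = 4 ^ n * 4 ^ n" by (simp flip: power_mult_distrib)
    then show ?thesis by simp
  qed
  finally show ?thesis unfolding e_def Q_def by (intro bexI[of _ S]) (auto simp: S_def)
qed

text \<open>The weight bound for a walk is summed over all possible sets \<open>S\<close>, since the
  right one depends on the walk. For fixed \<open>S\<close> the weights total at most 1, and the
  \<open>2 * 2 ^ n\<close> sets turn \<open>16 ^ n\<close> into \<open>2 * 32 ^ n\<close>.\<close>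

lemma sum_heavy_walks_le:
  fixes V :: "'a set" and p :: real and n :: nat
  assumes V: "finite V" and n: "n \<ge> 1" and p: "0 \<le> p" "p \<le> 1" and nd: "n \<le> p * card V"
  shows "(\<Sum>w\<in>heavy_walks V n. p ^ card (walk_edge w ` {..<n})) \<le>
    2 * card V * 32 ^ n * (p * card V) powr (n / 2) * n powr (3 * n / 8)"
proof -
  define K where "K = card V * 16 ^ n * (p * card V) powr (n / 2) * n powr (3 * n / 8)"
  define Q where "Q S w = (\<Prod>i<Suc n. step_weight V n S (take i w) (w ! i))" for S w
  have K0: "K \<ge> 0" by (simp add: K_def)
  have Q0: "Q S w \<ge> 0" for S w unfolding Q_def by (intro prod_nonneg step_weight_nonneg)
  have V0: "V \<noteq> {}" using n nd by auto
  have sub: "heavy_walks V n \<subseteq> seqs V (Suc n)" by (auto simp: heavy_walks_def)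
  have "(\<Sum>w\<in>heavy_walks V n. p ^ card (walk_edge w ` {..<n})) \<le>
        (\<Sum>w\<in>heavy_walks V n. \<Sum>S\<in>Pow {..n}. K * Q S w)"
  proof (rule sum_mono)
    fix w assume "w \<in> heavy_walks V n"
    then obtain S where S: "S \<in> Pow {..n}" "p ^ card (walk_edge w ` {..<n}) \<le> K * Q S w"
      using heavy_walk_weight[OF V n p nd] unfolding K_def Q_def by blast
    note S(2)
    also have "K * Q S w \<le> (\<Sum>S\<in>Pow {..n}. K * Q S w)"
      using S(1) K0 Q0 by (intro member_le_sum[of S _ "\<lambda>S. K * Q S w"]) auto
    finally show "p ^ card (walk_edge w ` {..<n}) \<le> (\<Sum>S\<in>Pow {..n}. K * Q S w)" .
  qed
  also have "\<dots> \<le> (\<Sum>w\<in>seqs V (Suc n). \<Sum>S\<in>Pow {..n}. K * Q S w)"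
    using sub K0 Q0 V by (intro sum_mono2 finite_seqs sum_nonneg) auto
  also have "\<dots> = (\<Sum>S\<in>Pow {..n}. K * (\<Sum>w\<in>seqs V (Suc n). Q S w))"
    by (subst sum.swap) (simp add: sum_distrib_left)
  also have "\<dots> \<le> (\<Sum>S\<in>Pow {..n}. K * 1)"
    unfolding Q_def using K0 V V0 n
    by (intro sum_mono mult_left_mono sum_adaptive_weights_le_1 step_weight_nonneg
        sum_step_weight_le_1) auto
  also have "\<dots> = 2 * 2 ^ n * K" by (simp add: card_Pow)
  also have "\<dots> = 2 * card V * 32 ^ n * (p * card V) powr (n / 2) * n powr (3 * n / 8)"
  proof -
    have "(32::real) ^ n = 2 ^ n * 16 ^ n" by (simp flip: power_mult_distrib)
    then show ?thesis by (simp add: K_def)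
  qed
  finally show ?thesis .
qed

section \<open>Traces of powers of a symmetric matrix\<close>

primrec mat_pow :: "'a set \<Rightarrow> ('a \<Rightarrow> 'a \<Rightarrow> real) \<Rightarrow> nat \<Rightarrow> 'a \<Rightarrow> 'a \<Rightarrow> real" where
  "mat_pow V A 0 x y = of_bool (x = y)"
| "mat_pow V A (Suc n) x y = (\<Sum>z\<in>V. mat_pow V A n x z * A z y)"

lemma sum_eq_single:
  fixes f :: "'a \<Rightarrow> real"
  assumes "finite V" "a \<in> V" "\<And>z. z \<in> V \<Longrightarrow> z \<noteq> a \<Longrightarrow> f z = 0"
  shows "sum f V = f a"
  using assms by (simp add: sum.remove[of V a])

lemma mat_pow_add:
  assumes "finite V" "y \<in> V"
  shows "mat_pow V A (m + n) x y = (\<Sum>z\<in>V. mat_pow V A m x z * mat_pow V A n z y)"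
  using assms(2)
proof (induction n arbitrary: y)
  case 0
  then show ?case using assms(1) by (subst sum_eq_single[of V y]) auto
next
  case (Suc n)
  have "mat_pow V A (m + Suc n) x y = (\<Sum>u\<in>V. \<Sum>z\<in>V. mat_pow V A m x z * mat_pow V A n z u * A u y)"
    using Suc.IH by (simp add: sum_distrib_right)
  also have "\<dots> = (\<Sum>z\<in>V. \<Sum>u\<in>V. mat_pow V A m x z * mat_pow V A n z u * A u y)"
    by (rule sum.swap)
  finally show ?case by (simp add: sum_distrib_left mult.assoc)
qed

lemma mat_pow_sym:
  assumes "finite V" "\<And>x y. A x y = A y x" "x \<in> V" "y \<in> V"
  shows "mat_pow V A n x y = mat_pow V A n y x"
  using assms(3,4)
proof (induction n arbitrary: x y)
  case (Suc n)
  have "mat_pow V A (Suc n) x y = (\<Sum>z\<in>V. mat_pow V A 1 y z * mat_pow V A n z x)"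
  proof -
    have one: "mat_pow V A 1 y z = A y z" if "z \<in> V" for z
      using assms(1) Suc.prems unfolding One_nat_def mat_pow.simps
      by (subst sum_eq_single[of V y]) auto
    have "mat_pow V A n x z * A z y = mat_pow V A 1 y z * mat_pow V A n z x" if z: "z \<in> V" for z
      unfolding one[OF z] Suc.IH[OF Suc.prems(1) z] assms(2)[of z y] by (rule mult.commute)
    then show ?thesis unfolding mat_pow.simps(2) by (intro sum.cong refl)
  qed
  also have "\<dots> = mat_pow V A (1 + n) y x" using assms(1) Suc.prems by (subst mat_pow_add) auto
  finally show ?case by simp
qed auto

lemma mat_pow_walks:
  assumes "finite V" "x \<in> V" "y \<in> V"
  shows "mat_pow V A n x y =
    (\<Sum>w\<in>seqs V (Suc n). of_bool (w ! 0 = x \<and> w ! n = y) * (\<Prod>i<n. A (w ! i) (w ! Suc i)))"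
  using assms(3)
proof (induction n arbitrary: y)
  case 0
  have e: "seqs V 0 = {[]}" by (auto simp: seqs_def)
  show ?case unfolding sum_seqs_Suc e using assms(1,2)
    by (subst sum.insert, simp, simp, subst sum_eq_single[of V x]) auto
next
  case (Suc n)
  have "(\<Sum>w\<in>seqs V (Suc (Suc n)). of_bool (w ! 0 = x \<and> w ! Suc n = y) * (\<Prod>i<Suc n. A (w ! i) (w ! Suc i)))
     = (\<Sum>w\<in>seqs V (Suc n). \<Sum>u\<in>V. of_bool (w ! 0 = x \<and> u = y) * ((\<Prod>i<n. A (w ! i) (w ! Suc i)) * A (w ! n) u))"
    unfolding sum_seqs_Suc[of _ V "Suc n"]
    by (intro sum.cong refl) (auto simp: seqs_def nth_append intro!: prod.cong)
  also have "\<dots> = (\<Sum>w\<in>seqs V (Suc n). of_bool (w ! 0 = x) * ((\<Prod>i<n. A (w ! i) (w ! Suc i)) * A (w ! n) y))"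
    using assms(1) Suc.prems
    by (intro sum.cong refl, subst sum_eq_single[of V y]) auto
  also have "\<dots> = (\<Sum>w\<in>seqs V (Suc n). \<Sum>z\<in>V. of_bool (w ! 0 = x \<and> w ! n = z) * (\<Prod>i<n. A (w ! i) (w ! Suc i)) * A z y)"
  proof (intro sum.cong refl)
    fix w assume "w \<in> seqs V (Suc n)"
    then have "w ! n \<in> V" by (auto simp: seqs_def subset_iff)
    then show "of_bool (w ! 0 = x) * ((\<Prod>i<n. A (w ! i) (w ! Suc i)) * A (w ! n) y) = 
       (\<Sum>z\<in>V. of_bool (w ! 0 = x \<and> w ! n = z) * (\<Prod>i<n. A (w ! i) (w ! Suc i)) * A z y)"
      using assms(1) by (subst sum_eq_single[of V "w ! n"]) auto
  qed
  also have "\<dots> = (\<Sum>z\<in>V. mat_pow V A n x z * A z y)"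
    by (subst sum.swap) (simp add: Suc.IH sum_distrib_right)
  finally show ?case by simp
qed

lemma trace_mat_pow:
  assumes "finite V"
  shows "(\<Sum>x\<in>V. mat_pow V A n x x) =
    (\<Sum>w\<in>seqs V (Suc n). of_bool (w ! 0 = w ! n) * (\<Prod>i<n. A (w ! i) (w ! Suc i)))"
proof -
  have "(\<Sum>x\<in>V. mat_pow V A n x x) =
     (\<Sum>w\<in>seqs V (Suc n). \<Sum>x\<in>V. of_bool (w ! 0 = x \<and> w ! n = x) * (\<Prod>i<n. A (w ! i) (w ! Suc i)))"
    using assms by (subst sum.swap) (simp add: mat_pow_walks)
  also have "\<dots> = (\<Sum>w\<in>seqs V (Suc n). of_bool (w ! 0 = w ! n) * (\<Prod>i<n. A (w ! i) (w ! Suc i)))"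
  proof (intro sum.cong refl)
    fix w assume "w \<in> seqs V (Suc n)"
    then have "w ! n \<in> V" by (auto simp: seqs_def subset_iff)
    then show "(\<Sum>x\<in>V. of_bool (w ! 0 = x \<and> w ! n = x) * (\<Prod>i<n. A (w ! i) (w ! Suc i))) =
      of_bool (w ! 0 = w ! n) * (\<Prod>i<n. A (w ! i) (w ! Suc i))"
      using assms by (subst sum_eq_single[of V "w ! n"]) auto
  qed
  finally show ?thesis .
qed

section \<open>Quadratic forms on indicator vectors, bounded by traces without eigenvalues\<close>

definition quad :: "'a set \<Rightarrow> ('a \<Rightarrow> 'a \<Rightarrow> real) \<Rightarrow> real" where
  "quad U A = (\<Sum>x\<in>U. \<Sum>y\<in>U. A x y)"

text \<open>By symmetry, the form of an even power is the squared norm of \<open>A\<close> to the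
  power \<open>n\<close> applied to the indicator vector of \<open>U\<close>.\<close>

lemma quad_mat_pow_double:
  assumes "finite V" "U \<subseteq> V" "\<And>x y. A x y = A y x"
  shows "quad U (mat_pow V A (n + n)) = (\<Sum>x\<in>V. (\<Sum>y\<in>U. mat_pow V A n x y)\<^sup>2)"
proof -
  have "quad U (mat_pow V A (n + n)) = (\<Sum>x\<in>U. \<Sum>y\<in>U. \<Sum>z\<in>V. mat_pow V A n z x * mat_pow V A n z y)"
    unfolding quad_def
  proof (intro sum.cong refl)
    fix x y assume "x \<in> U" "y \<in> U"
    then have xy: "x \<in> V" "y \<in> V" using assms(2) by auto
    show "mat_pow V A (n + n) x y = (\<Sum>z\<in>V. mat_pow V A n z x * mat_pow V A n z y)"
      unfolding mat_pow_add[OF assms(1) xy(2)]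
      by (intro sum.cong refl) (simp only: mat_pow_sym[OF assms(1,3) xy(1)])
  qed
  also have "\<dots> = (\<Sum>z\<in>V. \<Sum>x\<in>U. \<Sum>y\<in>U. mat_pow V A n z x * mat_pow V A n z y)"
    unfolding sum.swap[of _ V U] by (rule refl)
  also have "\<dots> = (\<Sum>z\<in>V. (\<Sum>y\<in>U. mat_pow V A n z y)\<^sup>2)"
    by (simp add: power2_eq_square sum_product)
  finally show ?thesis .
qed

text \<open>Cauchy-Schwarz over the entries in \<open>U\<close>, followed by extending the sum of
  squares to all of \<open>V\<close>.\<close>

lemma quad_mat_pow_square_le:
  assumes "finite V" "U \<subseteq> V" "\<And>x y. A x y = A y x"
  shows "(quad U (mat_pow V A n))\<^sup>2 \<le> card U * quad U (mat_pow V A (n + n))"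
proof -
  have "(quad U (mat_pow V A n))\<^sup>2 \<le> card U * (\<Sum>x\<in>U. (\<Sum>y\<in>U. mat_pow V A n x y)\<^sup>2)"
    unfolding quad_def by (subst mult.commute) (rule sum_squared_le_sum_of_squares)
  also have "\<dots> \<le> card U * (\<Sum>x\<in>V. (\<Sum>y\<in>U. mat_pow V A n x y)\<^sup>2)"
    using assms by (intro mult_left_mono sum_mono2) auto
  finally show ?thesis using quad_mat_pow_double[OF assms] by simp
qed

text \<open>Cauchy-Schwarz in each row bounds the squared norm by \<open>card U\<close> times the
  sum of all squared entries of the \<open>n\<close>-th power, which is the trace of its
  square.\<close>

lemma quad_mat_pow_le_trace:
  assumes "finite V" "U \<subseteq> V" "\<And>x y. A x y = A y x"
  shows "quad U (mat_pow V A (n + n)) \<le> card U * (\<Sum>x\<in>V. mat_pow V A (n + n) x x)"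
proof -
  have "quad U (mat_pow V A (n + n)) \<le> (\<Sum>x\<in>V. card U * (\<Sum>y\<in>V. (mat_pow V A n x y)\<^sup>2))"
    unfolding quad_mat_pow_double[OF assms]
  proof (rule sum_mono)
    fix x
    have "(\<Sum>y\<in>U. mat_pow V A n x y)\<^sup>2 \<le> card U * (\<Sum>y\<in>U. (mat_pow V A n x y)\<^sup>2)"
      by (subst mult.commute) (rule sum_squared_le_sum_of_squares)
    also have "\<dots> \<le> card U * (\<Sum>y\<in>V. (mat_pow V A n x y)\<^sup>2)"
      using assms by (intro mult_left_mono sum_mono2) auto
    finally show "(\<Sum>y\<in>U. mat_pow V A n x y)\<^sup>2 \<le> card U * (\<Sum>y\<in>V. (mat_pow V A n x y)\<^sup>2)" .
  qed
  also have "\<dots> = card U * (\<Sum>x\<in>V. \<Sum>y\<in>V. mat_pow V A n x y * mat_pow V A n y x)"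
    unfolding sum_distrib_left using assms
    by (intro sum.cong refl) (metis mat_pow_sym power2_eq_square)
  also have "\<dots> = card U * (\<Sum>x\<in>V. mat_pow V A (n + n) x x)"
    using assms(1) by (simp add: mat_pow_add)
  finally show ?thesis .
qed

lemma trace_mat_pow_double_nonneg:
  assumes "finite V" "\<And>x y. A x y = A y x"
  shows "0 \<le> (\<Sum>x\<in>V. mat_pow V A (n + n) x x)"
proof -
  have "(\<Sum>x\<in>V. mat_pow V A (n + n) x x) = (\<Sum>x\<in>V. \<Sum>y\<in>V. mat_pow V A n x y * mat_pow V A n x y)"
  proof (rule sum.cong[OF refl])
    fix x assume x: "x \<in> V"
    show "mat_pow V A (n + n) x x = (\<Sum>y\<in>V. mat_pow V A n x y * mat_pow V A n x y)"
      unfolding mat_pow_add[OF assms(1) x]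
      by (intro sum.cong refl) (simp only: mat_pow_sym[OF assms(1,2) x])
  qed
  then show ?thesis by (simp add: sum_nonneg)
qed

text \<open>Iterated Cauchy-Schwarz: each round squares the inequality and doubles the exponent,
  which is why walk lengths are powers of two.\<close>

lemma quad_pow_le:
  assumes "finite V" "U \<subseteq> V" "\<And>x y. A x y = A y x"
  shows "(quad U (mat_pow V A 1)) ^ (2 ^ t) * card U \<le> card U ^ (2 ^ t) * quad U (mat_pow V A (2 ^ t))"
proof (induction t)
  case (Suc t)
  show ?case
  proof (cases "card U = 0")
    case False
    let ?q = "\<lambda>n. quad U (mat_pow V A n)"
    have sq: "(?q n)\<^sup>2 \<le> card U * ?q (n + n)" for n
      using quad_mat_pow_square_le[of V U A] assms by blast
    \<comment> \<open>Squaring the induction hypothesis needs a nonnegative left side, which holds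
      once the exponent \<open>2 ^ t\<close> is even; the first doubling is therefore done
      directly.\<close>
    show ?thesis
    proof (cases t)
      case 0
      have "?q 1 ^ 2 ^ Suc t * card U = card U * (?q 1)\<^sup>2" using 0 by simp
      also have "\<dots> \<le> card U * (card U * ?q (1 + 1))" by (intro mult_left_mono sq) auto
      also have "\<dots> = card U ^ 2 ^ Suc t * ?q (2 ^ Suc t)"
        using 0 by (simp add: power2_eq_square numeral_2_eq_2 del: mat_pow.simps)
      finally show ?thesis .
    next
      case (Suc s)
      then have "0 \<le> ?q 1 ^ (2 ^ t)" by simp
      then have "(?q 1 ^ (2 ^ t) * card U)\<^sup>2 \<le> (card U ^ (2 ^ t) * ?q (2 ^ t))\<^sup>2"
        by (intro power_mono Suc.IH mult_nonneg_nonneg) auto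
      also have "\<dots> = (card U ^ (2 ^ t))\<^sup>2 * (?q (2 ^ t))\<^sup>2" by (simp add: power_mult_distrib)
      also have "\<dots> \<le> (card U ^ (2 ^ t))\<^sup>2 * (card U * ?q (2 ^ t + 2 ^ t))"
        by (intro mult_left_mono sq) auto
      finally have "(?q 1 ^ 2 ^ Suc t * card U) * card U \<le> (card U ^ 2 ^ Suc t * ?q (2 ^ Suc t)) * card U"
        by (simp add: power2_eq_square power_add mult_2 mult_ac)
      then show ?thesis by (rule mult_right_le_imp_le) (use False in simp)
    qed
  qed (auto simp: card_eq_0_iff quad_def)
qed simp

text \<open>Chaining the two bounds gives an inequality between even powers of
  \<open>quad U A\<close> and \<open>L * card U\<close>; the root can be taken because the latter is
  nonnegative.\<close>

lemma quad_le_of_trace: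
  assumes "finite V" "U \<subseteq> V" "\<And>x y. A x y = A y x" "L \<ge> 0"
    and tr: "(\<Sum>x\<in>V. mat_pow V A (2 ^ Suc t) x x) \<le> L ^ (2 ^ Suc t)"
  shows "quad U A \<le> L * card U"
proof (cases "card U = 0")
  case True
  then show ?thesis using finite_subset[OF assms(2,1)] by (simp add: quad_def)
next
  case False
  have one: "mat_pow V A 1 x y = A x y" if "x \<in> U" for x y
    using assms(1,2) that unfolding One_nat_def mat_pow.simps
    by (subst sum_eq_single[of V x]) auto
  then have q1: "quad U (mat_pow V A 1) = quad U A" by (simp add: quad_def)
  have "quad U A ^ (2 ^ Suc t) * card U \<le> card U ^ (2 ^ Suc t) * quad U (mat_pow V A (2 ^ t + 2 ^ t))"
    using quad_pow_le[OF assms(1,2), of A "Suc t"] assms(3) unfolding q1 by (simp add: mult_2)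
  also have "\<dots> \<le> card U ^ (2 ^ Suc t) * (card U * (\<Sum>x\<in>V. mat_pow V A (2 ^ t + 2 ^ t) x x))"
    using quad_mat_pow_le_trace[of V U A "2 ^ t"] assms(1-3) by (intro mult_left_mono) auto
  also have "\<dots> \<le> card U ^ (2 ^ Suc t) * (card U * L ^ (2 ^ Suc t))"
    using tr by (intro mult_left_mono) (auto simp: mult_2)
  finally have "quad U A ^ (2 ^ Suc t) * card U \<le> (L * card U) ^ (2 ^ Suc t) * card U"
    by (simp add: power_mult_distrib mult_ac)
  then have "quad U A ^ (2 ^ Suc t) \<le> (L * card U) ^ (2 ^ Suc t)"
    using False by (simp add: mult_le_cancel_right)
  moreover have "0 \<le> L * card U" using assms(4) by simp
  ultimately show ?thesis by (meson not_le power_strict_mono zero_less_numeral zero_less_power)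
qed

section \<open>The expected trace of the centred adjacency matrix\<close>

definition centred_adj :: "real \<Rightarrow> 'a set set \<Rightarrow> 'a \<Rightarrow> 'a \<Rightarrow> real" where
  "centred_adj p E x y = (if x = y then 0 else of_bool ({x, y} \<in> E) - p)"

lemma centred_adj_sym: "centred_adj p E x y = centred_adj p E y x"
  by (simp add: centred_adj_def insert_commute)

text \<open>The centred indicator has absolute value at most 1, so its higher powers are dominated
  by its square, whose expectation is the variance \<open>p - p\<^sup>2\<close>.\<close>

lemma centred_indicator_moment:
  fixes M :: "'b pmf" and A :: "'b set"
  assumes "measure_pmf.prob M A = p"
  defines "\<mu> m \<equiv> measure_pmf.expectation M (\<lambda>x. (indicat_real A x - p) ^ m)"
  shows "\<mu> 1 = 0" "m \<ge> 2 \<Longrightarrow> \<bar>\<mu> m\<bar> \<le> p"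
proof -
  have p: "0 \<le> p" "p \<le> 1" using assms by auto
  have int: "integrable M (\<lambda>x. indicat_real A x)"
    by (intro measure_pmf.integrable_const_bound[where B = 1]) (auto simp: indicator_def)
  have EA: "measure_pmf.expectation M (indicat_real A) = p" using assms(1) by simp
  then show "\<mu> 1 = 0" using int by (simp add: \<mu>_def)
  have le1: "\<bar>indicat_real A x - p\<bar> \<le> 1" for x using p by (auto simp: indicator_def)
  assume m: "m \<ge> 2"
  have "\<bar>\<mu> m\<bar> \<le> measure_pmf.expectation M (\<lambda>x. \<bar>(indicat_real A x - p) ^ m\<bar>)"
    unfolding \<mu>_def by (rule integral_abs_bound)
  also have "\<dots> \<le> measure_pmf.expectation M (\<lambda>x. (1 - 2 * p) * indicat_real A x + p\<^sup>2)"
  proof (rule integral_mono)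
    fix x
    have "\<bar>(indicat_real A x - p) ^ m\<bar> \<le> \<bar>indicat_real A x - p\<bar> ^ 2"
      unfolding power_abs using m le1 by (intro power_decreasing) auto
    also have "\<dots> = (1 - 2 * p) * indicat_real A x + p\<^sup>2"
      by (auto simp: indicator_def power2_eq_square algebra_simps)
    finally show "\<bar>(indicat_real A x - p) ^ m\<bar> \<le> (1 - 2 * p) * indicat_real A x + p\<^sup>2" .
  next
    show "integrable M (\<lambda>x. \<bar>(indicat_real A x - p) ^ m\<bar>)"
      using le1 by (intro measure_pmf.integrable_const_bound[where B = 1]) (auto simp: power_abs power_le_one)
  qed (use int in auto)
  also have "\<dots> = p - p\<^sup>2" using int EA by (simp add: power2_eq_square algebra_simps)
  also have "\<dots> \<le> p" by simp
  finally show "\<bar>\<mu> m\<bar> \<le> p" .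
qed

text \<open>A walk has at most \<open>n \<le> k\<close> distinct edges, so the expectation factors
  into one central moment per edge. An edge walked once contributes 0, any other at most
  \<open>p\<close> in absolute value. A step that stays put meets the zero diagonal.\<close>

lemma expectation_closed_walk:
  fixes G :: "nat set set pmf"
  assumes prob: "\<forall>e\<in>potential_edges N. measure_pmf.prob G {E. e \<in> E} = p"
    and indep: "\<forall>S\<subseteq>potential_edges N. card S \<le> k \<longrightarrow>
      prob_space.indep_vars (measure_pmf G) (\<lambda>_. borel) (\<lambda>e. indicat_real {E. e \<in> E}) S"
    and n: "n \<le> k" and w: "w \<in> seqs {1..N} (Suc n)" "w ! 0 = w ! n"
  shows "measure_pmf.expectation G (\<lambda>E. \<Prod>i<n. centred_adj p E (w ! i) (w ! Suc i))
     \<le> (if w \<in> heavy_walks {1..N} n then p ^ card (walk_edge w ` {..<n}) else 0)"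
proof (cases "\<exists>i<n. w ! i = w ! Suc i")
  case True
  then obtain i where "i < n" "w ! i = w ! Suc i" by blast
  then have z: "(\<Prod>i<n. centred_adj p E (w ! i) (w ! Suc i)) = 0" for E
    by (intro prod_zero) (auto simp: centred_adj_def)
  have "w \<notin> heavy_walks {1..N} n" using True by (auto simp: heavy_walks_def)
  then show ?thesis unfolding z by simp
next
  case False
  define T where "T = walk_edge w ` {..<n}"
  define m where "m e = card {i \<in> {..<n}. walk_edge w i = e}" for e
  define X where "X e = indicat_real {E. e \<in> E}" for e :: "nat set"
  define \<mu> where "\<mu> e = measure_pmf.expectation G (\<lambda>E. (X e E - p) ^ m e)" for e
  have inV: "w ! i \<in> {1..N}" if "i \<le> n" for i
    using w(1) that by (auto simp: seqs_def subset_iff)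
  have T: "T \<subseteq> potential_edges N"
  proof
    fix e assume "e \<in> T"
    then obtain i where "i < n" "e = {w ! i, w ! Suc i}" by (auto simp: T_def walk_edge_def)
    then show "e \<in> potential_edges N"
      using False inV[of i] inV[of "Suc i"] by (auto simp: potential_edges_def nsets_def)
  qed
  have finT: "finite T" by (simp add: T_def)
  have "card T \<le> k" using n card_image_le[of "{..<n}" "walk_edge w"] by (simp add: T_def)
  then have "prob_space.indep_vars (measure_pmf G) (\<lambda>_. borel) X T"
    using indep T unfolding X_def by blast
  then have ind: "prob_space.indep_vars (measure_pmf G) (\<lambda>_. borel) (\<lambda>e E. (X e E - p) ^ m e) T"
    by (rule prob_space.indep_vars_compose2[OF prob_space_measure_pmf, where Y = "\<lambda>e x. (x - p) ^ m e"]) measurable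
  have "measure_pmf.expectation G (\<lambda>E. \<Prod>i<n. centred_adj p E (w ! i) (w ! Suc i))
      = measure_pmf.expectation G (\<lambda>E. \<Prod>e\<in>T. (X e E - p) ^ m e)"
  proof (intro Bochner_Integration.integral_cong refl)
    fix E
    have "(\<Prod>i<n. centred_adj p E (w ! i) (w ! Suc i)) = (\<Prod>i<n. X (walk_edge w i) E - p)"
      using False by (intro prod.cong) (auto simp: centred_adj_def X_def walk_edge_def)
    also have "\<dots> = (\<Prod>e\<in>T. \<Prod>i\<in>{i \<in> {..<n}. walk_edge w i = e}. X (walk_edge w i) E - p)"
      unfolding T_def by (rule prod.image_gen) simp
    also have "\<dots> = (\<Prod>e\<in>T. \<Prod>i\<in>{i \<in> {..<n}. walk_edge w i = e}. X e E - p)"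
      by (intro prod.cong) auto
    finally show "(\<Prod>i<n. centred_adj p E (w ! i) (w ! Suc i)) = (\<Prod>e\<in>T. (X e E - p) ^ m e)"
      by (simp add: m_def)
  qed
  also have "\<dots> = (\<Prod>e\<in>T. \<mu> e)"
    unfolding \<mu>_def
  proof (intro prob_space.indep_vars_lebesgue_integral[OF prob_space_measure_pmf finT ind])
    fix e
    show "integrable (measure_pmf G) (\<lambda>E. (X e E - p) ^ m e)"
      by (intro measure_pmf.integrable_const_bound[where B = "(1 + \<bar>p\<bar>) ^ m e"])
        (auto simp: X_def power_abs indicator_def intro!: power_mono)
  qed
  finally have eq: "measure_pmf.expectation G (\<lambda>E. \<Prod>i<n. centred_adj p E (w ! i) (w ! Suc i)) = (\<Prod>e\<in>T. \<mu> e)" .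
  have \<mu>1: "\<mu> e = 0" if "e \<in> T" "m e = 1" for e
    using centred_indicator_moment(1)[of G "{E. e \<in> E}" p] that prob T by (auto simp: \<mu>_def X_def)
  show ?thesis
  proof (cases "w \<in> heavy_walks {1..N} n")
    case True
    have "\<bar>\<mu> e\<bar> \<le> p" if e: "e \<in> T" for e
    proof -
      obtain i where i: "i < n" "walk_edge w i = e" using e by (auto simp: T_def)
      then obtain j where j: "j < n" "j \<noteq> i" "walk_edge w j = e" using True by (auto simp: heavy_walks_def)
      have "card {i, j} \<le> m e" unfolding m_def using i j by (intro card_mono) auto
      then have "m e \<ge> 2" using j by simp
      then show ?thesis
        using centred_indicator_moment(2)[of G "{E. e \<in> E}" p "m e"] e prob T by (auto simp: \<mu>_def X_def)
    qed
    then have "(\<Prod>e\<in>T. \<bar>\<mu> e\<bar>) \<le> (\<Prod>e\<in>T. p)" by (intro prod_mono) auto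
    moreover have "(\<Prod>e\<in>T. \<mu> e) \<le> \<bar>\<Prod>e\<in>T. \<mu> e\<bar>" by simp
    ultimately show ?thesis using True eq by (simp add: abs_prod T_def)
  next
    case nh: False
    then obtain i where i: "i < n" "\<forall>j<n. j \<noteq> i \<longrightarrow> walk_edge w j \<noteq> walk_edge w i"
      using False w by (auto simp: heavy_walks_def)
    then have "{j \<in> {..<n}. walk_edge w j = walk_edge w i} = {i}" by auto
    then have "m (walk_edge w i) = 1" by (simp add: m_def)
    moreover have "walk_edge w i \<in> T" using i by (auto simp: T_def)
    ultimately have "(\<Prod>e\<in>T. \<mu> e) = 0" using \<mu>1 finT by (intro prod_zero) auto
    then show ?thesis using nh eq by simp
  qed
qed

text \<open>Markov's inequality: the trace is nonnegative with mean at most \<open>B\<close>, so it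
  reaches \<open>N * B\<close> with probability at most \<open>1 / N\<close>. Below that it is at
  most \<open>L ^ n\<close>, which controls all \<open>U\<close> at once.\<close>

lemma prob_quad_le:
  fixes G :: "nat set set pmf" and p L :: real and n :: nat
  assumes prob: "\<forall>e\<in>potential_edges N. measure_pmf.prob G {E. e \<in> E} = p"
    and indep: "\<forall>S\<subseteq>potential_edges N. card S \<le> k \<longrightarrow>
      prob_space.indep_vars (measure_pmf G) (\<lambda>_. borel) (\<lambda>e. indicat_real {E. e \<in> E}) S"
    and supp: "set_pmf G \<subseteq> Pow (potential_edges N)"
    and p: "0 \<le> p" "p \<le> 1" and n: "n = 2 ^ Suc t" "n \<le> k" "n \<le> p * N" and L: "L \<ge> 0"
    and LB: "real N * (2 * real N * 32 ^ n * (p * N) powr (n / 2) * n powr (3 * n / 8)) \<le> L ^ n"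
  shows "measure_pmf.prob G {E. \<forall>U\<subseteq>{1..N}. quad U (centred_adj p E) \<le> L * card U} \<ge> 1 - 1 / N"
proof -
  let ?V = "{1..N}"
  define B :: real where "B = 2 * real N * 32 ^ n * (p * N) powr (n / 2) * n powr (3 * n / 8)"
  define tr where "tr E = (\<Sum>x\<in>?V. mat_pow ?V (centred_adj p E) n x x)" for E
  have n1: "n \<ge> 1" using n(1) by simp
  have pN: "p * N > 0" using n1 n(3) by linarith
  then have N: "N > 0" by (cases N) auto
  have B: "B > 0" unfolding B_def using n1 pN N by (intro mult_pos_pos) auto
  have "finite (potential_edges N)"
    by (auto simp: potential_edges_def intro: finite_imp_finite_nsets)
  then have fin: "finite (set_pmf G)" using supp finite_subset by blast
  have integ: "integrable (measure_pmf G) f" for f :: "nat set set \<Rightarrow> real"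
    using fin by (rule integrable_measure_pmf_finite)
  have "measure_pmf.expectation G tr =
    (\<Sum>w\<in>seqs ?V (Suc n). of_bool (w ! 0 = w ! n) *
       measure_pmf.expectation G (\<lambda>E. \<Prod>i<n. centred_adj p E (w ! i) (w ! Suc i)))"
    unfolding tr_def trace_mat_pow[OF finite_atLeastAtMost]
    by (subst Bochner_Integration.integral_sum) (auto intro: integ)
  also have "\<dots> \<le> (\<Sum>w\<in>seqs ?V (Suc n). if w \<in> heavy_walks ?V n then p ^ card (walk_edge w ` {..<n}) else 0)"
  proof (intro sum_mono)
    fix w assume w: "w \<in> seqs ?V (Suc n)"
    show "of_bool (w ! 0 = w ! n) *
        measure_pmf.expectation G (\<lambda>E. \<Prod>i<n. centred_adj p E (w ! i) (w ! Suc i))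
      \<le> (if w \<in> heavy_walks ?V n then p ^ card (walk_edge w ` {..<n}) else 0)"
    proof (cases "w ! 0 = w ! n")
      case True
      show ?thesis using expectation_closed_walk[OF prob indep n(2) w True] True
        by (simp only: of_bool_eq mult_1 simp_thms)
    qed (use p in simp)
  qed
  also have "\<dots> = (\<Sum>w\<in>heavy_walks ?V n. p ^ card (walk_edge w ` {..<n}))"
    by (subst sum.inter_restrict[symmetric])
      (auto simp: finite_seqs heavy_walks_def intro!: sum.cong)
  also have "\<dots> \<le> B"
    using sum_heavy_walks_le[of ?V n p] n1 n(3) p by (simp add: B_def)
  finally have E: "measure_pmf.expectation G tr \<le> B" .
  have tr0: "tr E \<ge> 0" for E
    unfolding tr_def using trace_mat_pow_double_nonneg[of ?V "centred_adj p E" "2 ^ t"]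
    by (simp add: n(1) mult_2 centred_adj_sym)
  have "measure_pmf.prob G {E. N * B \<le> tr E} \<le> measure_pmf.expectation G tr / (N * B)"
    using integral_Markov_inequality_measure[OF integ[of tr], of "UNIV" "N * B"] tr0 N B by simp
  also have "\<dots> \<le> B / (N * B)" using E N B by (intro divide_right_mono) auto
  also have "\<dots> = 1 / N" using B by simp
  finally have "1 - 1 / N \<le> 1 - measure_pmf.prob G {E. N * B \<le> tr E}" by simp
  also have "\<dots> = measure_pmf.prob G (UNIV - {E. N * B \<le> tr E})"
    using measure_pmf.prob_compl[of "{E. N * B \<le> tr E}" G] by simp
  also have "\<dots> \<le> measure_pmf.prob G {E. \<forall>U\<subseteq>?V. quad U (centred_adj p E) \<le> L * card U}"
  proof (rule measure_pmf.finite_measure_mono)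
    show "UNIV - {E. N * B \<le> tr E} \<subseteq> {E. \<forall>U\<subseteq>?V. quad U (centred_adj p E) \<le> L * card U}"
    proof safe
      fix E U assume "U \<subseteq> ?V" "\<not> N * B \<le> tr E"
      then have "tr E \<le> L ^ n" using LB unfolding B_def by linarith
      then show "quad U (centred_adj p E) \<le> L * card U"
        using \<open>U \<subseteq> ?V\<close> L centred_adj_sym
        by (intro quad_le_of_trace[of ?V U _ _ t]) (auto simp: tr_def n(1))
    qed
  qed auto
  finally show ?thesis .
qed

section \<open>Colouring\<close>

text \<open>Pick a vertex of low degree and discard it with its neighbours, where the
  \<open>1 +\<close> in \<open>low\<close> counts the vertex itself. Each pick keeps a share of at
  least \<open>1 - \<beta>\<close>, so the set stays above \<open>u0\<close> for \<open>s\<close>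
  picks.\<close>

lemma independent_set_greedy:
  fixes V :: "'a set" and E :: "'a set set" and \<beta> u0 :: real
  assumes V: "finite V" and loopless: "\<And>v. {v} \<notin> E" and \<beta>: "0 \<le> \<beta>" "\<beta> < 1" 
    and low: "\<And>U. U \<subseteq> V \<Longrightarrow> u0 \<le> card U \<Longrightarrow> \<exists>v\<in>U. 1 + real (card {y\<in>U. {v, y} \<in> E}) \<le> \<beta> * card U"
    and U: "U \<subseteq> V" "u0 \<le> card U * (1 - \<beta>) ^ s"
  shows "\<exists>I\<subseteq>U. card I = s \<and> (\<forall>x\<in>I. \<forall>y\<in>I. {x, y} \<notin> E)"
  using U
proof (induction s arbitrary: U)
  case 0
  then show ?case by (intro exI[of _ "{}"]) auto
next
  case (Suc s)
  have fU: "finite U" using Suc.prems V finite_subset by blast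
  have "card U * (1 - \<beta>) ^ Suc s \<le> real (card U) * 1"
    using \<beta> by (intro mult_left_mono power_le_one) auto
  then have "u0 \<le> card U" using Suc.prems by linarith
  then obtain v where v: "v \<in> U" "1 + real (card {y\<in>U. {v, y} \<in> E}) \<le> \<beta> * card U"
    using low[of U] Suc.prems by blast
  define U' where "U' = {y\<in>U. y \<noteq> v \<and> {v, y} \<notin> E}"
  have "card U \<le> card (U' \<union> insert v {y\<in>U. {v, y} \<in> E})"
    using fU by (intro card_mono) (auto simp: U'_def)
  also have "\<dots> \<le> card U' + card (insert v {y\<in>U. {v, y} \<in> E})" by (rule card_Un_le)
  also have "\<dots> \<le> card U' + (1 + card {y\<in>U. {v, y} \<in> E})"
    using fU by (simp add: card_insert_if)
  finally have "real (card U) \<le> card U' + (1 + card {y\<in>U. {v, y} \<in> E})" by (simp only: of_nat_le_iff)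
  then have "(1 - \<beta>) * card U \<le> card U'" using v by (simp add: algebra_simps)
  then have "(1 - \<beta>) * card U * (1 - \<beta>) ^ s \<le> card U' * (1 - \<beta>) ^ s"
    using \<beta> by (intro mult_right_mono) auto
  then have "u0 \<le> card U' * (1 - \<beta>) ^ s" using Suc.prems by (simp add: mult_ac)
  moreover have "U' \<subseteq> V" using Suc.prems by (auto simp: U'_def)
  ultimately obtain I where I: "I \<subseteq> U'" "card I = s" "\<forall>x\<in>I. \<forall>y\<in>I. {x, y} \<notin> E"
    using Suc.IH[of U'] by blast
  have "finite I" "v \<notin> I" using I fU by (auto simp: U'_def intro: finite_subset)
  then show ?case using I v loopless
    by (intro exI[of _ "insert v I"]) (auto simp: U'_def insert_commute)
qed

lemma degenerate_colouring:
  fixes W :: "'a set" and E :: "'a set set"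
  assumes W: "finite W" and loopless: "\<And>v. {v} \<notin> E"
    and low: "\<And>U. U \<subseteq> W \<Longrightarrow> U \<noteq> {} \<Longrightarrow> \<exists>v\<in>U. card {y\<in>U. {v, y} \<in> E} \<le> D"
  shows "\<exists>f. proper_colouring W E (Suc D) f"
  using W low
proof (induction "card W" arbitrary: W)
  case 0
  then show ?case by (auto simp: proper_colouring_def)
next
  case (Suc n)
  then have "W \<noteq> {}" by auto
  then obtain v where v: "v \<in> W" "card {y\<in>W. {v, y} \<in> E} \<le> D" using Suc.prems by blast
  have "\<exists>f. proper_colouring (W - {v}) E (Suc D) f"
    using Suc v by (intro Suc.hyps(1)) auto
  then obtain f where f: "proper_colouring (W - {v}) E (Suc D) f" by blast
  have "card (f ` {y\<in>W. {v, y} \<in> E}) \<le> D"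
    using card_image_le[of "{y\<in>W. {v, y} \<in> E}" f] v Suc.prems by auto
  then have "\<not> {..<Suc D} \<subseteq> f ` {y\<in>W. {v, y} \<in> E}"
    using card_mono[of "f ` {y\<in>W. {v, y} \<in> E}" "{..<Suc D}"] Suc.prems by auto
  then obtain c where c: "c < Suc D" "c \<notin> f ` {y\<in>W. {v, y} \<in> E}" by blast
  have "proper_colouring W E (Suc D) (f(v := c))"
    using f c loopless unfolding proper_colouring_def
    by (auto simp: image_iff insert_commute)
  then show ?case by blast
qed

text \<open>While at least \<open>u1\<close> vertices remain, one new colour removes
  \<open>s\<close> of them; the last \<open>m\<close> colours serve the remainder.\<close>

lemma colouring_by_independent_sets:
  fixes V :: "'a set" and E :: "'a set set" and u1 :: real
  assumes V: "finite V" and s: "s > 0"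
    and indep: "\<And>U. U \<subseteq> V \<Longrightarrow> u1 \<le> card U \<Longrightarrow> \<exists>I\<subseteq>U. card I = s \<and> (\<forall>x\<in>I. \<forall>y\<in>I. {x, y} \<notin> E)"
    and small: "\<And>U. U \<subseteq> V \<Longrightarrow> card U < u1 \<Longrightarrow> \<exists>f. proper_colouring U E m f"
    and U: "U \<subseteq> V"
  shows "\<exists>M f. proper_colouring U E M f \<and> real M \<le> card U / s + m"
  using U
proof (induction "card U" arbitrary: U rule: less_induct)
  case less
  have fU: "finite U" using less.prems V finite_subset by blast
  show ?case
  proof (cases "u1 \<le> card U")
    case True
    then obtain I where I: "I \<subseteq> U" "card I = s" "\<forall>x\<in>I. \<forall>y\<in>I. {x, y} \<notin> E"
      using indep less.prems by blast
    have card: "card (U - I) = card U - s" "s \<le> card U"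
      using I fU by (auto simp: card_Diff_subset finite_subset card_mono)
    then have "card (U - I) < card U" using s by linarith
    then obtain M f where f: "proper_colouring (U - I) E M f" "real M \<le> card (U - I) / s + m"
      using less.hyps[of "U - I"] less.prems by blast
    have lt: "f x < M" if "x \<in> U" "x \<notin> I" for x using f that by (auto simp: proper_colouring_def)
    have "proper_colouring U E (Suc M) (\<lambda>x. if x \<in> I then M else f x)"
      unfolding proper_colouring_def
    proof (intro conjI ballI impI)
      show "(\<lambda>x. if x \<in> I then M else f x) ` U \<subseteq> {..<Suc M}" using lt by (auto simp: less_Suc_eq)
      fix x y assume "x \<in> U" "y \<in> U" "{x, y} \<in> E"
      then show "(if x \<in> I then M else f x) \<noteq> (if y \<in> I then M else f y)"
        using lt[of x] lt[of y] I f by (auto simp: proper_colouring_def)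
    qed
    moreover have "real (Suc M) \<le> card U / s + m"
      using f(2) card s by (simp add: of_nat_diff diff_divide_distrib)
    ultimately show ?thesis by blast
  next
    case False
    then obtain f where "proper_colouring U E m f" using small less.prems by force
    then show ?thesis by (intro exI[of _ m] exI[of _ f]) auto
  qed
qed

section \<open>From quadratic forms to the chromatic number\<close>

lemma chromatic_number_le: "proper_colouring V E m f \<Longrightarrow> chromatic_number V E \<le> m"
  unfolding chromatic_number_def by (rule Least_le) blast

text \<open>Averaging: if all degrees in \<open>U\<close> were larger, every row sum of the centred
  matrix would exceed \<open>L\<close>.\<close>

lemma exists_low_degree_vertex:
  fixes U :: "'a set" and p L :: real
  assumes U: "finite U" "U \<noteq> {}" and p: "p \<ge> 0" and loopless: "\<And>v. {v} \<notin> E"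
    and quad: "quad U (centred_adj p E) \<le> L * card U"
  shows "\<exists>v\<in>U. real (card {y\<in>U. {v, y} \<in> E}) \<le> p * card U + L"
proof (rule ccontr)
  assume "\<not> ?thesis"
  then have big: "real (card {y\<in>U. {v, y} \<in> E}) > p * card U + L" if "v \<in> U" for v
    using that by (auto simp: not_le)
  have row: "(\<Sum>y\<in>U. centred_adj p E v y) > L" if v: "v \<in> U" for v
  proof -
    have "real (card {y\<in>U. {v, y} \<in> E}) - p * card U = (\<Sum>y\<in>U. of_bool ({v, y} \<in> E) - p)"
      using U by (simp add: sum_subtractf of_bool_def sum.If_cases Int_def)
    \<comment> \<open>Only the diagonal term differs: without loops it is \<open>-p\<close> on the
      left and 0 on the right.\<close>
    also have "\<dots> \<le> (\<Sum>y\<in>U. centred_adj p E v y)"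
      using p loopless by (intro sum_mono) (auto simp: centred_adj_def)
    finally show ?thesis using big[OF v] by linarith
  qed
  have "(\<Sum>v\<in>U. L) < quad U (centred_adj p E)"
    unfolding quad_def using U row by (intro sum_strict_mono) auto
  then show False using quad by (simp add: mult.commute)
qed

text \<open>The threshold depends on \<open>d\<close> alone and is uniform in \<open>N\<close>,
  \<open>p\<close> and \<open>E\<close>, so that the lemma can be applied along any sequence with
  \<open>d\<close> tending to infinity.\<close>

lemma chromatic_number_le_of_quad:
  "\<forall>\<^sub>F d in at_top. \<forall>N (p::real) E. p * real N = d \<longrightarrow> 0 < p \<longrightarrow> p \<le> 1 / 2 \<longrightarrow> (\<forall>v. {v} \<notin> E) \<longrightarrow>
     (\<forall>U\<subseteq>{1..N}. quad U (centred_adj p E) \<le> 1024 * d powr (7/8) * card U) \<longrightarrow>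
     real (chromatic_number {1..N} E) \<le> 200 * d / ln d"
proof -
  have "\<forall>\<^sub>F d::real in at_top. d > 1" by real_asymp
  \<comment> \<open>The exponents compare as 28/32 < 30/32 - 1/32: greedy picking from a set of size
    \<open>u1\<close> never falls below \<open>4 * L / p\<close>.\<close>
  moreover have "\<forall>\<^sub>F d::real in at_top. 4 * (1024 * d powr (7/8)) \<le> d powr (15/16) * (1 / 4 * d powr (-1/32))"
    by real_asymp
  moreover have "\<forall>\<^sub>F d::real in at_top. 192 * d / ln d + (d powr (15/16) + 1024 * d powr (7/8)) + 1 \<le> 200 * d / ln d"
    by real_asymp
  ultimately show ?thesis
  proof eventually_elim
    case (elim d)
    define L where "L = 1024 * d powr (7/8)"
    have L1: "L \<ge> 1" unfolding L_def using elim(1) ge_one_powr_ge_zero[of d "7/8"] by linarith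
    show ?case
    proof (intro allI impI)
      fix N :: nat and p :: real and E :: "nat set set"
      assume d: "p * real N = d" and p: "0 < p" "p \<le> 1 / 2" and loopless: "\<forall>v. {v} \<notin> E"
        and "\<forall>U\<subseteq>{1..N}. quad U (centred_adj p E) \<le> 1024 * d powr (7/8) * card U"
      then have quad: "quad U (centred_adj p E) \<le> L * card U" if "U \<subseteq> {1..N}" for U
        using that by (simp add: L_def)
      define u1 where "u1 = d powr (15/16) / p"
      \<comment> \<open>Once \<open>p * card W \<ge> 4 * L\<close> with \<open>L \<ge> 1\<close>,
        the degree bound plus one is at most \<open>p * card W + 2 * L\<close>, hence at most
        \<open>3 / 2 * p * card W\<close>.\<close>
      define \<beta> where "\<beta> = 3 / 2 * p"
      \<comment> \<open>As \<open>192 = 6 * 32\<close> and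
        \<open>1 - \<beta> \<ge> exp (- (6 * p))\<close>, the first \<open>s - 1\<close> picks keep
        a share of at least \<open>d powr (-1/32)\<close>. The pick added by rounding up costs a
        further factor of at most 4.\<close>
      define s where "s = nat \<lceil>ln d / (192 * p)\<rceil>"
      have lnd: "ln d > 0" using elim(1) by simp
      have s0: "s > 0" using lnd p by (simp add: s_def)
      have s1: "real s \<ge> ln d / (192 * p)" and s2: "real s \<le> ln d / (192 * p) + 1"
        using lnd p unfolding s_def by simp_all
      have \<beta>: "0 \<le> \<beta>" "\<beta> < 1" using p by (auto simp: \<beta>_def)
      have decay: "(1 - \<beta>) ^ s \<ge> 1 / 4 * d powr (-1/32)"
      proof -
        have ge: "1 - \<beta> \<ge> exp (- (6 * p))"
        proof -
          \<comment> \<open>\<open>1/(1 - \<beta>) = 1 + \<beta>/(1 - \<beta>) \<le> 1 + 4 \<beta>\<close> as \<open>\<beta> \<le> 3/4\<close>\<close>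
          have "1 / (1 - \<beta>) \<le> 1 + 6 * p" using p by (simp add: \<beta>_def field_simps)
          also have "\<dots> \<le> exp (6 * p)" by (rule exp_ge_add_one_self)
          finally show ?thesis using \<beta> by (simp add: exp_minus field_simps)
        qed
        obtain r where r: "s = Suc r" using s0 by (cases s) auto
        have "real r * (192 * p) \<le> ln d" using s2 p by (simp add: r field_simps)
        then have "d powr (-1/32) \<le> exp (real r * - (6 * p))"
          using elim(1) by (simp add: powr_def)
        also have "\<dots> = exp (- (6 * p)) ^ r" by (rule exp_of_nat_mult)
        also have "\<dots> \<le> (1 - \<beta>) ^ r" using ge by (intro power_mono) auto
        finally have "1 / 4 * d powr (-1/32) \<le> (1 - \<beta>) * (1 - \<beta>) ^ r"
          using p by (intro mult_mono) (auto simp: \<beta>_def)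
        then show ?thesis by (simp add: r)
      qed
      have low: "\<exists>v\<in>U. real (card {y\<in>U. {v, y} \<in> E}) \<le> p * card U + L"
        if "U \<subseteq> {1..N}" "U \<noteq> {}" for U
        using that p loopless quad[of U] by (intro exists_low_degree_vertex) (auto intro: finite_subset)
      have indep: "\<exists>I\<subseteq>U. card I = s \<and> (\<forall>x\<in>I. \<forall>y\<in>I. {x, y} \<notin> E)"
        if U: "U \<subseteq> {1..N}" "u1 \<le> card U" for U
      proof (rule independent_set_greedy[of "{1..N}" E \<beta> "4 * L / p" U s])
        show "4 * L / p \<le> card U * (1 - \<beta>) ^ s"
        proof -
          have "4 * L / p \<le> u1 * (1 / 4 * d powr (-1/32))"
            using elim(2) p by (simp add: u1_def L_def field_simps)
          also have "\<dots> \<le> card U * (1 - \<beta>) ^ s"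
            using U decay by (intro mult_mono) auto
          finally show ?thesis .
        qed
        fix W assume W: "W \<subseteq> {1..N}" "4 * L / p \<le> card W"
        have "4 * L \<le> p * card W" using W p by (simp add: field_simps)
        moreover have "W \<noteq> {}" using W L1 p by (auto simp: field_simps)
        then obtain v where "v \<in> W" "real (card {y\<in>W. {v, y} \<in> E}) \<le> p * card W + L"
          using low W by blast
        ultimately show "\<exists>v\<in>W. 1 + real (card {y\<in>W. {v, y} \<in> E}) \<le> \<beta> * card W"
          using L1 by (intro bexI[of _ v]) (auto simp: \<beta>_def)
      qed (use U \<beta> loopless in auto)
      \<comment> \<open>The degree bound \<open>p * card W + L\<close> at the threshold
        \<open>card W = u1\<close>.\<close>
      define D where "D = nat \<lfloor>d powr (15/16) + L\<rfloor>"
      have small: "\<exists>f. proper_colouring U E (Suc D) f" if U: "U \<subseteq> {1..N}" "card U < u1" for U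
      proof (rule degenerate_colouring)
        show "finite U" using U finite_subset by blast
        fix W assume W: "W \<subseteq> U" "W \<noteq> {}"
        then obtain v where v: "v \<in> W" "real (card {y\<in>W. {v, y} \<in> E}) \<le> p * card W + L"
          using low[of W] U by blast
        have "card W \<le> card U" using W \<open>finite U\<close> by (intro card_mono)
        then have "p * card W \<le> p * u1" using U p by (intro mult_left_mono) auto
        then have "real (card {y\<in>W. {v, y} \<in> E}) \<le> d powr (15/16) + L"
          using v p by (simp add: u1_def)
        then show "\<exists>v\<in>W. card {y\<in>W. {v, y} \<in> E} \<le> D"
          using v by (intro bexI[of _ v]) (auto simp: D_def le_nat_floor)
      qed (use loopless in auto)
      obtain M f where M: "proper_colouring {1..N} E M f" "real M \<le> card {1..N} / s + Suc D"
        using colouring_by_independent_sets[of "{1..N}" s u1 E "Suc D" "{1..N}"] s0 indep small by blast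
      have "real (chromatic_number {1..N} E) \<le> M" using chromatic_number_le[OF M(1)] by simp
      also have "real M \<le> N / s + D + 1" using M(2) by simp
      also have "N / s \<le> 192 * d / ln d"
      proof -
        have "N / s \<le> N / (ln d / (192 * p))"
          using s0 s1 lnd p by (intro divide_left_mono) auto
        also have "\<dots> = 192 * d / ln d" by (simp add: d[symmetric])
        finally show ?thesis .
      qed
      also have "real D \<le> d powr (15/16) + L"
        unfolding D_def using L1 by (intro of_nat_floor) (auto intro: add_nonneg_nonneg)
      finally show "real (chromatic_number {1..N} E) \<le> 200 * d / ln d"
        using elim(3) by (simp add: L_def)
    qed
  qed
qed

section \<open>Choice of the walk length\<close>

lemma exists_power_of_two_between:
  fixes x :: real
  assumes "x \<ge> 2"
  shows "\<exists>t. 2 ^ Suc t \<le> x \<and> x < 2 * 2 ^ Suc t"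
proof -
  define m where "m = nat \<lfloor>log 2 x\<rfloor>"
  have l: "log 2 x \<ge> 1" using assms by (simp add: le_log_iff)
  then have m: "m \<ge> 1" "real m \<le> log 2 x" "log 2 x < real m + 1"
    unfolding m_def by (auto simp: le_nat_iff) 
  have "2 powr m \<le> x" using m assms by (simp add: le_log_iff)
  moreover have "x < 2 powr (real m + 1)" using m assms by (simp add: log_less_iff)
  ultimately show ?thesis using m(1)
    by (intro exI[of _ "m - 1"]) (simp add: powr_realpow powr_add mult.commute del: power_Suc)
qed

text \<open>For walks of length 8 the right side contains \<open>d ^ 7\<close> and the left side
  \<open>N ^ 2 * d ^ 4\<close>, so \<open>N ^ 2 \<le> d ^ 3\<close> suffices; this holds because 3 *
  74/75 exceeds 2.\<close>

lemma trace_bound_dense: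
  fixes d :: real and N :: nat
  assumes "N \<ge> 1" "d \<ge> real N powr (74/75)"
  shows "real N * (2 * real N * 32 ^ 8 * d powr (real 8 / 2) * real 8 powr (3 * real 8 / 8))
    \<le> (1024 * d powr (7/8)) ^ 8"
proof -
  have "1 \<le> real N powr (74/75)" using assms(1) by (intro ge_one_powr_ge_zero) auto
  then have d: "d \<ge> 1" using assms(2) by linarith
  have "real N powr 2 \<le> real N powr (74/75 * 3)" using assms(1) by (intro powr_mono) auto
  also have "\<dots> = (real N powr (74/75)) ^ 3" using assms(1) by (simp add: powr_power)
  also have "\<dots> \<le> d ^ 3" using assms(2) by (intro power_mono) auto
  finally have N2: "real N ^ 2 \<le> d ^ 3" using assms(1) by simp
  have "(d powr (7/8)) ^ 8 = d ^ 7" using d by (simp add: powr_power)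
  moreover have "d powr (real 8 / 2) = d ^ 4" using d by simp
  moreover have "real 8 powr (3 * real 8 / 8) = 512" by simp
  moreover have "(real N ^ 2) * (1024 * 32 ^ 8 * d ^ 4) \<le> d ^ 3 * (1024 ^ 8 * d ^ 4)"
    using N2 d by (intro mult_mono) auto
  ultimately show ?thesis by (simp add: power_mult_distrib power2_eq_square mult_ac flip: power_add)
qed

text \<open>The factor \<open>2 * N ^ 2\<close> is absorbed by a second \<open>32 ^ n\<close>,
  giving 1024 per step, and \<open>n \<le> d\<close> merges the exponents 1/2 + 3/8 = 7/8.\<close>

lemma trace_bound_sparse:
  fixes d :: real and N n :: nat
  assumes "n \<ge> 1" "n \<le> d" "real N \<le> 4 ^ n"
  shows "real N * (2 * real N * 32 ^ n * d powr (real n / 2) * real n powr (3 * real n / 8))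
    \<le> (1024 * d powr (7/8)) ^ n"
proof -
  have NN: "real N * real N \<le> 4 ^ n * 4 ^ n" using assms by (intro mult_mono) auto
  have "(2::real) ^ 1 \<le> 2 ^ n" using assms(1) by (intro power_increasing) auto
  then have "2 * (real N * real N) \<le> 2 ^ n * (4 ^ n * 4 ^ n)"
    using NN by (intro mult_mono[of 2 "2 ^ n" "real N * real N"]) simp_all
  also have "\<dots> = 32 ^ n" by (simp flip: power_mult_distrib)
  finally have N: "2 * (real N * real N) \<le> 32 ^ n" .
  have "real n powr (3 * real n / 8) \<le> d powr (3 * real n / 8)"
    using assms by (intro powr_mono2) auto
  then have "2 * (real N * real N) * (32 ^ n * (d powr (real n / 2) * real n powr (3 * real n / 8)))
     \<le> 32 ^ n * (32 ^ n * (d powr (real n / 2) * d powr (3 * real n / 8)))"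
    using N by (intro mult_mono) auto
  also have "d powr (real n / 2) * d powr (3 * real n / 8) = (d powr (7/8)) ^ n"
    using assms by (simp add: powr_power field_simps flip: powr_add)
  also have "32 ^ n * (32 ^ n * (d powr (7/8)) ^ n) = (1024 * d powr (7/8)) ^ n"
    by (simp add: power_mult_distrib flip: mult.assoc) (simp flip: power_mult_distrib)
  finally show ?thesis by (simp add: mult_ac)
qed

section \<open>Assembly of the two density regimes\<close>

theorem mainTheorem9:
  "\<exists>c::real. c > 0 \<and>
    (\<forall>(k :: nat \<Rightarrow> nat) (p :: nat \<Rightarrow> real) (G :: nat \<Rightarrow> nat set set pmf).
       kwise_independent_random_graph k p G \<longrightarrow>
       (\<forall>\<^sub>F N in sequentially. p N \<le> 1 / 2) \<longrightarrow>
       (\<forall>\<^sub>F N in sequentially. k N \<ge> 12 \<and> p N \<ge> real N powr (- 1 / 75)) \<or>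
       (\<forall>\<^sub>F N in sequentially. real (k N) \<ge> log 2 (real N) \<and> p N \<ge> c * log 2 (real N) / real N) \<longrightarrow>
       (\<lambda>N. measure_pmf.prob (G N)
              {E. real (chromatic_number {1..N} E)
                    \<le> c * real N * log 2 (1 / (1 - p N)) / log 2 (p N * real N)})
         \<longlonglongrightarrow> 1)"
proof (intro exI[of _ "200::real"] conjI allI impI)
  fix k :: "nat \<Rightarrow> nat" and p :: "nat \<Rightarrow> real" and G :: "nat \<Rightarrow> nat set set pmf"
  assume G: "kwise_independent_random_graph k p G" and half: "\<forall>\<^sub>F N in sequentially. p N \<le> 1 / 2"
    and cases: "(\<forall>\<^sub>F N in sequentially. k N \<ge> 12 \<and> p N \<ge> real N powr (- 1 / 75)) \<or>
       (\<forall>\<^sub>F N in sequentially. real (k N) \<ge> log 2 (real N) \<and> p N \<ge> 200 * log 2 (real N) / real N)"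
  \<comment> \<open>An admissible walk length \<open>2 ^ Suc t\<close>: covered by the independence,
    at most the expected degree scale \<open>p N * N\<close>, and long enough for the trace
    bound.\<close>
  let ?ok = "\<lambda>N t. 2 ^ Suc t \<le> k N \<and> 2 ^ Suc t \<le> p N * real N \<and>
    real N * (2 * real N * 32 ^ (2 ^ Suc t) * (p N * real N) powr (real (2 ^ Suc t) / 2)
      * real (2 ^ Suc t) powr (3 * real (2 ^ Suc t) / 8)) \<le> (1024 * (p N * real N) powr (7/8)) ^ (2 ^ Suc t)"
  have *: "filterlim (\<lambda>N. p N * real N) at_top sequentially \<and> (\<forall>\<^sub>F N in sequentially. \<exists>t. ?ok N t)"
    using cases
  proof
    assume ev: "\<forall>\<^sub>F N in sequentially. k N \<ge> 12 \<and> p N \<ge> real N powr (- 1 / 75)"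
    have d: "\<forall>\<^sub>F N in sequentially. real N powr (74/75) \<le> p N * real N"
      using ev eventually_gt_at_top[of 0]
    proof eventually_elim
      case (elim N)
      have "real N powr (74/75) = real N powr (- 1 / 75) * real N powr 1"
        by (subst powr_add[symmetric]) simp
      also have "\<dots> \<le> p N * real N" using elim by simp
      finally show ?case .
    qed
    have lim: "filterlim (\<lambda>N. real N powr (74/75)) at_top sequentially" by real_asymp
    then have lim': "filterlim (\<lambda>N. p N * real N) at_top sequentially"
      using d by (rule filterlim_at_top_mono)
    then have "\<forall>\<^sub>F N in sequentially. 8 \<le> p N * real N" by (simp add: filterlim_at_top)
    with d ev eventually_ge_at_top[of 1] have "\<forall>\<^sub>F N in sequentially. \<exists>t. ?ok N t"
    proof eventually_elim
      case (elim N)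
      \<comment> \<open>The witness 2 means walk length \<open>2 ^ 3 = 8\<close>, within the
        independence \<open>k N \<ge> 12\<close>.\<close>
      then show ?case using trace_bound_dense[of N "p N * real N"] by (intro exI[of _ 2]) simp
    qed
    with lim' show ?thesis by blast
  next
    assume ev: "\<forall>\<^sub>F N in sequentially. real (k N) \<ge> log 2 (real N) \<and> p N \<ge> 200 * log 2 (real N) / real N"
    have d: "\<forall>\<^sub>F N in sequentially. 200 * log 2 (real N) \<le> p N * real N"
      using ev eventually_gt_at_top[of 0]
      by eventually_elim (simp add: field_simps)
    have lim: "filterlim (\<lambda>N. 200 * log 2 (real N)) at_top sequentially" by real_asymp
    then have lim': "filterlim (\<lambda>N. p N * real N) at_top sequentially"
      using d by (rule filterlim_at_top_mono)
    have "\<forall>\<^sub>F N in sequentially. 2 \<le> log 2 (real N)" by real_asymp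
    with d ev eventually_ge_at_top[of 1] have "\<forall>\<^sub>F N in sequentially. \<exists>t. ?ok N t"
    proof eventually_elim
      case (elim N)
      obtain t where t: "2 ^ Suc t \<le> log 2 (real N)" "log 2 (real N) < 2 * 2 ^ Suc t"
        using exists_power_of_two_between elim by blast
      define n :: nat where "n = 2 ^ Suc t"
      have n: "real n \<le> log 2 (real N)" "log 2 (real N) < 2 * real n" "n \<ge> 1"
        using t by (auto simp: n_def)
      have nd: "real n \<le> p N * real N" "n \<le> k N" using n elim by linarith+
      \<comment> \<open>A length above half of \<open>log 2 N\<close> makes \<open>N\<close> at most
        exponential in \<open>n\<close>, as the sparse trace bound requires.\<close>
      have "real N < 2 powr (2 * real n)" using n elim by (simp add: log_less_iff)
      also have "\<dots> = 4 ^ n" by (simp add: powr_realpow powr_powr[symmetric])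
      finally have "real N * (2 * real N * 32 ^ n * (p N * real N) powr (real n / 2)
         * real n powr (3 * real n / 8)) \<le> (1024 * (p N * real N) powr (7/8)) ^ n"
        using n nd by (intro trace_bound_sparse) auto
      then show ?case using nd unfolding n_def by (intro exI[of _ t]) simp
    qed
    with lim' show ?thesis by blast
  qed
  let ?P = "\<lambda>N. measure_pmf.prob (G N) {E. real (chromatic_number {1..N} E)
     \<le> 200 * real N * log 2 (1 / (1 - p N)) / log 2 (p N * real N)}"
  have "\<forall>\<^sub>F N in sequentially. 1 < p N * real N"
    using * by (simp add: filterlim_at_top_dense)
  moreover have "\<forall>\<^sub>F N in sequentially. \<forall>N' (q::real) E. q * real N' = p N * real N \<longrightarrow> 0 < q \<longrightarrow> q \<le> 1 / 2 \<longrightarrow> (\<forall>v. {v} \<notin> E) \<longrightarrow>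
     (\<forall>U\<subseteq>{1..N'}. quad U (centred_adj q E) \<le> 1024 * (p N * real N) powr (7/8) * card U) \<longrightarrow>
     real (chromatic_number {1..N'} E) \<le> 200 * (p N * real N) / ln (p N * real N)"
    using eventually_compose_filterlim[OF chromatic_number_le_of_quad conjunct1[OF *]] .
  ultimately have "\<forall>\<^sub>F N in sequentially. 1 - 1 / real N \<le> ?P N"
    using conjunct2[OF *] half
  proof eventually_elim
    case (elim N)
    define d where "d = p N * real N"
    define L where "L = 1024 * d powr (7/8)"
    obtain t where t: "2 ^ Suc t \<le> k N" "2 ^ Suc t \<le> d"
      "real N * (2 * real N * 32 ^ (2 ^ Suc t) * d powr (real (2 ^ Suc t) / 2)
        * real (2 ^ Suc t) powr (3 * real (2 ^ Suc t) / 8)) \<le> L ^ (2 ^ Suc t)"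
      using elim(3) unfolding d_def L_def by blast
    have p: "p N > 0" using elim(1) by (metis less_le_trans mult_nonpos_nonneg not_le of_nat_0_le_iff zero_less_one less_trans)
    have "1 - 1 / real N \<le> measure_pmf.prob (G N) {E. \<forall>U\<subseteq>{1..N}. quad U (centred_adj (p N) E) \<le> L * card U}"
      using G t p elim(4) unfolding kwise_independent_random_graph_def d_def
      by (intro prob_quad_le[where k = "k N" and n = "2 ^ Suc t" and t = t]) (auto simp: L_def)
    also have "\<dots> \<le> ?P N"
    \<comment> \<open>The inclusion of events holds only on the support, where edge sets have no
      loops.\<close>
    proof (rule measure_pmf.finite_measure_mono_AE)
      have "real (chromatic_number {1..N} E) \<le> 200 * real N * log 2 (1 / (1 - p N)) / log 2 d"
        if E: "E \<in> set_pmf (G N)" "\<forall>U\<subseteq>{1..N}. quad U (centred_adj (p N) E) \<le> L * card U" for E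
      proof -
        have "set_pmf (G N) \<subseteq> Pow (potential_edges N)"
          using G unfolding kwise_independent_random_graph_def by blast
        then have "E \<subseteq> potential_edges N" using E(1) by blast
        then have "\<forall>v. {v} \<notin> E" by (auto simp: potential_edges_def nsets_def)
        then have "real (chromatic_number {1..N} E) \<le> 200 * d / ln d"
          using elim(2) E(2) p elim(4) unfolding d_def L_def by blast
        \<comment> \<open>Here \<open>p \<le> - ln (1 - p)\<close>; the quotient of logarithms does
          not depend on the base.\<close>
        also have "\<dots> \<le> 200 * (real N * - ln (1 - p N)) / ln d"
        proof -
          have "ln (1 - p N) \<le> - p N" using ln_le_minus_one[of "1 - p N"] elim(4) by simp
          then have "real N * p N \<le> real N * - ln (1 - p N)" by (intro mult_left_mono) auto
          then show ?thesis using elim(1) unfolding d_def by (intro divide_right_mono) (auto simp: mult.commute)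
        qed
        also have "\<dots> = 200 * real N * log 2 (1 / (1 - p N)) / log 2 d"
          using elim(4) by (simp add: log_def ln_div)
        finally show ?thesis .
      qed
      then show "AE E in measure_pmf (G N). E \<in> {E. \<forall>U\<subseteq>{1..N}. quad U (centred_adj (p N) E) \<le> L * card U} \<longrightarrow>
         E \<in> {E. real (chromatic_number {1..N} E) \<le> 200 * real N * log 2 (1 / (1 - p N)) / log 2 (p N * real N)}"
        by (auto simp: AE_measure_pmf_iff d_def)
    qed auto
    finally show ?case .
  qed
  moreover have "(\<lambda>N. 1 - 1 / real N) \<longlonglongrightarrow> 1" by real_asymp
  ultimately show "?P \<longlonglongrightarrow> 1"
    by (intro tendsto_sandwich[of "\<lambda>N. 1 - 1 / real N" ?P sequentially "\<lambda>_. 1"]) auto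
qed simp

end
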